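(* Let $\mathcal{H}$ be a separable Hilbert space and let $V$ be an elliptical random element in $\mathcal{H}$ with $E(V)=0$ and with a compact covariance operator $\Gamma_V$. If $k$ principal points of $V$ span a linear subspace $\mathcal{W}$ of dimension $q$, then $\mathcal{W}$ is also spanned by $q$ eigenfunctions of $\Gamma_V$ related to the $q$ largest eigenvalues of $\Gamma_V$ (eigenvalues counted with multiplicity).
   Context: All Hilbert spaces are real. Multivariate elliptical distribution: a random vector $X\in\mathbb{R}^d$ is elliptical, $X\sim\mathcal{E}_d(\mu,\Sigma)$, if there are $\mu\in\mathbb{R}^d$, a positive semidefinite $\Sigma\in\mathbb{R}^{d\times d}$ and a function $\phi:\mathbb{R}_+\to\mathbb{R}$ such that the characteristic function of $X-\mu$ is $t\mapsto\phi(t^{T}\Sigma t)$, $t\in\mathbb{R}^d$. Elliptical random element: a random element $V$ of a separable Hilbert space $\mathcal{H}$ is elliptical with parameters $\mu\in\mathcal{H}$ and $\Gamma:\mathcal{H}\to\mathcal{H}$ (self-adjoint, positive semidefinite, compact), written $V\sim\mathcal{E}(\mu,\Gamma)$, if for every $d$ and every bounded linear operator $A:\mathcal{H}\to\mathbb{R}^d$ one has $AV\sim\mathcal{E}_d(A\mu,A\Gamma A^* )$, where $A^*$ is the adjoint of $A$. $V$ is called elliptical if this holds for some $\mu,\Gamma$. Covariance operator: $\Gamma_V$ is defined by $\langle\Gamma_V u,v\rangle=\mathrm{Cov}(\langle u,V\rangle,\langle v,V\rangle)$ for $u,v\in\mathcal{H}$; its existence presupposes $E(\|V\|^2)<\infty$.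 Eigenvalues are ordered $\lambda_1\ge\lambda_2\ge\cdots$ with an associated orthonormal basis of eigenfunctions $\phi_1,\phi_2,\ldots$ of $\mathcal{H}$ (in case of ties the eigenfunctions are not unique, and the conclusion is for a suitable choice of them). Principal points: for $y_1,\ldots,y_k\in\mathcal{H}$ put $d(V,\{y_1,\ldots,y_k\})=\min_{1\le j\le k}\|V-y_j\|$. For $V$ with $E(\|V\|^2)<\infty$, elements $\xi_1,\ldots,\xi_k\in\mathcal{H}$ are called ($k$) principal points of $V$ if $E(d^2(V,\{\xi_1,\ldots,\xi_k\}))=\min_{y_1,\ldots,y_k\in\mathcal{H}}E(d^2(V,\{y_1,\ldots,y_k\}))$. *)

theory Defs
  imports "HOL-Probability.Probability"
begin

text \<open>
  A separable real Hilbert space is a type of sort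
  \<open>{real_inner, banach, second_countable_topology}\<close>; for metric spaces, separability and
  second countability coincide.  As the dimension \<open>d\<close> is quantified inside the definition of
  an elliptical random element, vectors of \<open>\<real>\<^sup>d\<close> and \<open>d \<times> d\<close> matrices are functions on
  \<open>nat\<close>, resp. \<open>nat \<Rightarrow> nat\<close>, of which only the values at indices below \<open>d\<close> matter.
\<close>

section \<open>Elliptical distributions on \<open>\<real>\<^sup>d\<close>\<close>

definition psd_matrix :: "nat \<Rightarrow> (nat \<Rightarrow> nat \<Rightarrow> real) \<Rightarrow> bool" where
  "psd_matrix d S \<longleftrightarrow>
     (\<forall>i<d. \<forall>j<d. S i j = S j i) \<and>
     (\<forall>t. (\<Sum>i<d. \<Sum>j<d. t i * S i j * t j) \<ge> 0)"

definition mv_char :: "'w measure \<Rightarrow> nat \<Rightarrow> ('w \<Rightarrow> nat \<Rightarrow> real) \<Rightarrow> (nat \<Rightarrow> real) \<Rightarrow> complex" where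
  "mv_char M d X t = (CLINT w|M. iexp (\<Sum>i<d. t i * X w i))"

text \<open>
  The generator \<open>\<phi>\<close> is a function on \<open>[0, \<infinity>)\<close>; it is only evaluated at the nonnegative
  values of the quadratic form.
\<close>

definition elliptical_vec ::
    "'w measure \<Rightarrow> nat \<Rightarrow> ('w \<Rightarrow> nat \<Rightarrow> real) \<Rightarrow> (nat \<Rightarrow> real) \<Rightarrow> (nat \<Rightarrow> nat \<Rightarrow> real) \<Rightarrow> bool" where
  "elliptical_vec M d X m S \<longleftrightarrow>
     (\<forall>i<d. (\<lambda>w. X w i) \<in> borel_measurable M) \<and>
     psd_matrix d S \<and>
     (\<exists>\<phi> :: real \<Rightarrow> real. \<forall>t.
        mv_char M d (\<lambda>w i. X w i - m i) t
          = complex_of_real (\<phi> (\<Sum>i<d. \<Sum>j<d. t i * S i j * t j)))"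

section \<open>Operators\<close>

definition compact_operator :: "('a::real_normed_vector \<Rightarrow> 'a) \<Rightarrow> bool" where
  "compact_operator G \<longleftrightarrow> bounded_linear G \<and> compact (closure (G ` cball 0 1))"

definition selfadjoint_operator :: "('a::real_inner \<Rightarrow> 'a) \<Rightarrow> bool" where
  "selfadjoint_operator G \<longleftrightarrow> (\<forall>u v. G u \<bullet> v = u \<bullet> G v)"

definition psd_operator :: "('a::real_inner \<Rightarrow> 'a) \<Rightarrow> bool" where
  "psd_operator G \<longleftrightarrow> (\<forall>u. G u \<bullet> u \<ge> 0)"

text \<open>
  Since \<open>\<real>\<^sup>d\<close> is finite-dimensional, a map into it is linear and bounded iff all its
  components are.
\<close>

definition bounded_linear_vec :: "nat \<Rightarrow> ('a::real_normed_vector \<Rightarrow> nat \<Rightarrow> real) \<Rightarrow> bool" where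
  "bounded_linear_vec d A \<longleftrightarrow> (\<forall>i<d. bounded_linear (\<lambda>x. A x i))"

text \<open>
  The adjoint \<open>A\<^sup>* : \<real>\<^sup>d \<rightarrow> H\<close>; it exists on a Hilbert space by the Riesz representation
  theorem when \<open>A\<close> is bounded and linear.
\<close>

definition adjoint_vec :: "nat \<Rightarrow> ('a::real_inner \<Rightarrow> nat \<Rightarrow> real) \<Rightarrow> (nat \<Rightarrow> real) \<Rightarrow> 'a" where
  "adjoint_vec d A y = (THE z. \<forall>x. (\<Sum>i<d. A x i * y i) = x \<bullet> z)"

definition unit_vec :: "nat \<Rightarrow> nat \<Rightarrow> real" where
  "unit_vec j = (\<lambda>i. if i = j then 1 else 0)"

text \<open>The matrix of \<open>A G A\<^sup>* : \<real>\<^sup>d \<rightarrow> \<real>\<^sup>d\<close> in the standard basis.\<close>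

definition conj_matrix ::
    "nat \<Rightarrow> ('a::real_inner \<Rightarrow> nat \<Rightarrow> real) \<Rightarrow> ('a \<Rightarrow> 'a) \<Rightarrow> nat \<Rightarrow> nat \<Rightarrow> real" where
  "conj_matrix d A G i j = A (G (adjoint_vec d A (unit_vec j))) i"

section \<open>Elliptical random elements of a Hilbert space\<close>

definition elliptical_with ::
    "'w measure \<Rightarrow> ('w \<Rightarrow> 'a::{real_inner, banach, second_countable_topology})
      \<Rightarrow> 'a \<Rightarrow> ('a \<Rightarrow> 'a) \<Rightarrow> bool" where
  "elliptical_with M V m G \<longleftrightarrow>
     V \<in> borel_measurable M \<and>
     selfadjoint_operator G \<and> psd_operator G \<and> compact_operator G \<and>
     (\<forall>d A. bounded_linear_vec d A \<longrightarrow>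
        elliptical_vec M d (\<lambda>w. A (V w)) (A m) (conj_matrix d A G))"

definition elliptical ::
    "'w measure \<Rightarrow> ('w \<Rightarrow> 'a::{real_inner, banach, second_countable_topology}) \<Rightarrow> bool" where
  "elliptical M V \<longleftrightarrow> (\<exists>m G. elliptical_with M V m G)"

section \<open>Covariance operator\<close>

definition covariance :: "'w measure \<Rightarrow> ('w \<Rightarrow> real) \<Rightarrow> ('w \<Rightarrow> real) \<Rightarrow> real" where
  "covariance M X Y =
     (\<integral>w. (X w - (\<integral>w'. X w' \<partial>M)) * (Y w - (\<integral>w'. Y w' \<partial>M)) \<partial>M)"

text \<open>
  Meaningful when \<open>E (\<parallel>V\<parallel>\<^sup>2) < \<infinity>\<close>; the lemma \<open>covariance_operator_inner\<close> below shows that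
  the description is then satisfied.
\<close>

definition covariance_operator :: "'w measure \<Rightarrow> ('w \<Rightarrow> 'a::real_inner) \<Rightarrow> 'a \<Rightarrow> 'a" where
  "covariance_operator M V u =
     (THE z. \<forall>v. z \<bullet> v = covariance M (\<lambda>w. u \<bullet> V w) (\<lambda>w. v \<bullet> V w))"

lemma covariance_operator_inner:
  fixes V :: "'w \<Rightarrow> 'a::{real_inner, banach, second_countable_topology}"
  assumes M: "prob_space M" and V [measurable]: "V \<in> borel_measurable M"
    and sq: "integrable M (\<lambda>w. (norm (V w))\<^sup>2)"
  shows "covariance_operator M V u \<bullet> v = covariance M (\<lambda>w. u \<bullet> V w) (\<lambda>w. v \<bullet> V w)"
proof -
  interpret prob_space M by fact
  have iV: "integrable M V"
  proof (rule Bochner_Integration.integrable_bound)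
    show "integrable M (\<lambda>w. 1 + (norm (V w))\<^sup>2)" using sq by simp
    show "AE w in M. norm (V w) \<le> norm (1 + (norm (V w))\<^sup>2)"
    proof (rule AE_I2)
      fix w
      have "0 \<le> (norm (V w) - 1)\<^sup>2" by simp
      then have "2 * norm (V w) \<le> 1 + (norm (V w))\<^sup>2" by (simp add: power2_diff)
      then have "norm (V w) \<le> 1 + (norm (V w))\<^sup>2"
        using norm_ge_zero[of "V w"] by linarith
      then show "norm (V w) \<le> norm (1 + (norm (V w))\<^sup>2)"
        unfolding real_norm_def by linarith
    qed
  qed simp
  define c where "c = (\<integral>w. u \<bullet> V w \<partial>M)"
  have i2: "integrable M (\<lambda>w. (u \<bullet> V w) *\<^sub>R V w)"
  proof (rule Bochner_Integration.integrable_bound)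
    show "integrable M (\<lambda>w. norm u * (norm (V w))\<^sup>2)" using sq by simp
    show "AE w in M. norm ((u \<bullet> V w) *\<^sub>R V w) \<le> norm (norm u * (norm (V w))\<^sup>2)"
    proof (rule AE_I2)
      fix w
      have "\<bar>u \<bullet> V w\<bar> * norm (V w) \<le> (norm u * norm (V w)) * norm (V w)"
        by (rule mult_right_mono[OF Cauchy_Schwarz_ineq2]) simp
      then show "norm ((u \<bullet> V w) *\<^sub>R V w) \<le> norm (norm u * (norm (V w))\<^sup>2)"
        by (simp add: power2_eq_square mult.assoc)
    qed
  qed simp
  have i3: "integrable M (\<lambda>w. (u \<bullet> V w - c) *\<^sub>R (V w - (\<integral>w'. V w' \<partial>M)))"
    using i2 iV by (auto simp: algebra_simps)
  define z where "z = (\<integral>w. (u \<bullet> V w - c) *\<^sub>R (V w - (\<integral>w'. V w' \<partial>M)) \<partial>M)"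
  have z: "\<forall>v. z \<bullet> v = covariance M (\<lambda>w. u \<bullet> V w) (\<lambda>w. v \<bullet> V w)"
  proof
    fix v
    have "z \<bullet> v = (\<integral>w. ((u \<bullet> V w - c) *\<^sub>R (V w - (\<integral>w'. V w' \<partial>M))) \<bullet> v \<partial>M)"
      unfolding z_def by (rule integral_inner_left[symmetric]) (rule i3)
    also have "\<dots> = covariance M (\<lambda>w. u \<bullet> V w) (\<lambda>w. v \<bullet> V w)"
      unfolding covariance_def c_def using iV
      by (simp add: inner_diff_left inner_diff_right inner_commute)
    finally show "z \<bullet> v = covariance M (\<lambda>w. u \<bullet> V w) (\<lambda>w. v \<bullet> V w)" .
  qed
  have "covariance_operator M V u = z"
    unfolding covariance_operator_def
  proof (rule the_equality)
    fix z' assume "\<forall>v. z' \<bullet> v = covariance M (\<lambda>w. u \<bullet> V w) (\<lambda>w. v \<bullet> V w)"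
    with z have "\<forall>v. (z' - z) \<bullet> v = 0" by (simp add: inner_diff_left)
    then have "(z' - z) \<bullet> (z' - z) = 0" by blast
    then show "z' = z" by simp
  qed (rule z)
  then show ?thesis using z by simp
qed

section \<open>Principal points\<close>

definition dist_points :: "'a::real_normed_vector \<Rightarrow> nat \<Rightarrow> (nat \<Rightarrow> 'a) \<Rightarrow> real" where
  "dist_points x k y = Min ((\<lambda>j. norm (x - y j)) ` {..<k})"

definition principal_points ::
    "'w measure \<Rightarrow> ('w \<Rightarrow> 'a::real_normed_vector) \<Rightarrow> nat \<Rightarrow> (nat \<Rightarrow> 'a) \<Rightarrow> bool" where
  "principal_points M V k \<xi> \<longleftrightarrow>
     k \<ge> 1 \<and>
     integrable M (\<lambda>w. (norm (V w))\<^sup>2) \<and>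
     (\<forall>y. (\<integral>w. (dist_points (V w) k \<xi>)\<^sup>2 \<partial>M) \<le> (\<integral>w. (dist_points (V w) k y)\<^sup>2 \<partial>M))"

section \<open>Leading eigenfunctions\<close>

definition orthonormal_basis :: "'a::real_inner set \<Rightarrow> bool" where
  "orthonormal_basis B \<longleftrightarrow>
     (\<forall>e\<in>B. norm e = 1) \<and> pairwise orthogonal B \<and> closure (span B) = UNIV"

definition eigenfunction :: "('a::real_vector \<Rightarrow> 'a) \<Rightarrow> real \<Rightarrow> 'a \<Rightarrow> bool" where
  "eigenfunction G l e \<longleftrightarrow> e \<noteq> 0 \<and> G e = l *\<^sub>R e"

text \<open>
  \<open>f 0, \<dots>, f (q - 1)\<close> are the first \<open>q\<close> members of an orthonormal basis of eigenfunctions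
  ordered by decreasing eigenvalue.  The rest of the basis is not enumerated: if there are
  infinitely many positive eigenvalues and a nontrivial kernel, no enumeration by the natural
  numbers of the whole basis has decreasing eigenvalues.  Working with members of a basis
  counts the eigenvalues with multiplicity.
\<close>

definition leading_eigenfunctions ::
    "('a::real_inner \<Rightarrow> 'a) \<Rightarrow> nat \<Rightarrow> (nat \<Rightarrow> 'a) \<Rightarrow> bool" where
  "leading_eigenfunctions G q f \<longleftrightarrow>
     (\<exists>B l. orthonormal_basis B \<and> (\<forall>e\<in>B. eigenfunction G (l e) e) \<and>
        inj_on f {..<q} \<and> f ` {..<q} \<subseteq> B \<and>
        (\<forall>i j. i \<le> j \<and> j < q \<longrightarrow> l (f j) \<le> l (f i)) \<and>
        (\<forall>i<q. \<forall>e \<in> B - f ` {..<q}. l e \<le> l (f i)))"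

end

theory Submission
  imports Defs
begin

text \<open>
  Up to the constant \<open>E \<parallel>V\<parallel>\<^sup>2\<close>, the objective of points \<open>y\<^sub>1, \<dots>, y\<^sub>k\<close> is
  \<open>E (min\<^sub>j (\<parallel>y\<^sub>j\<parallel>\<^sup>2 - 2 \<langle>V, y\<^sub>j\<rangle>))\<close>, so it depends only on the law of the vector of the
  \<open>\<langle>V, y\<^sub>j\<rangle>\<close>, which by ellipticity is determined by the numbers \<open>\<langle>C y\<^sub>i, y\<^sub>j\<rangle>\<close>, where \<open>C\<close> is the
  covariance operator.  Principal points with cells of positive mass are the conditional means of
  their cells.  If \<open>u \<bottom> C W\<close>, then replacing \<open>\<langle>V, u\<rangle>\<close> by \<open>- \<langle>V, u\<rangle>\<close> does not change its joint
  law with the \<open>\<langle>V, \<xi>\<^sub>j\<rangle>\<close>, so \<open>\<langle>V, u\<rangle>\<close> has mean zero on every cell and \<open>u \<bottom> W\<close>; hence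
  \<open>W \<subseteq> C W\<close>, and \<open>W\<close> is invariant under \<open>C\<close>.  If some eigenvector in \<open>W\<close> had a smaller
  eigenvalue than one orthogonal to \<open>W\<close>, rotating the first into the second would lower the
  objective.  If a cell is null, then \<open>V \<in> W\<close> almost surely and \<open>C\<close> vanishes on the orthogonal
  complement of \<open>W\<close>.
\<close>

section \<open>Uniqueness of characteristic functions of random vectors\<close>

text \<open>The case \<open>t = 0\<close> shows that both weights have the same total mass
  \<open>c\<close>. If \<open>c > 0\<close>, the densities \<open>g / c\<close> and
  \<open>h / c\<close> give probability measures whose images under \<open>X\<close> and
  \<open>Y\<close> share their characteristic function, so Levy's uniqueness theorem applies; if
  \<open>c = 0\<close>, both weights vanish almost everywhere.\<close>

lemma weighted_law_unique:
  fixes X Y g h :: "'w \<Rightarrow> real"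
  assumes X [measurable]: "X \<in> borel_measurable M" and Y [measurable]: "Y \<in> borel_measurable M"
    and g: "integrable M g" "\<And>w. 0 \<le> g w" and h: "integrable M h" "\<And>w. 0 \<le> h w"
    and eq: "\<And>t. (CLINT w|M. g w *\<^sub>R iexp (t * X w)) = (CLINT w|M. h w *\<^sub>R iexp (t * Y w))"
    and A [measurable]: "A \<in> sets borel"
  shows "(\<integral>w. g w * indicator A (X w) \<partial>M) = (\<integral>w. h w * indicator A (Y w) \<partial>M)"
proof -
  define c where "c = integral\<^sup>L M g"
  have [measurable]: "g \<in> borel_measurable M" "h \<in> borel_measurable M"
    using g h by auto
  have "complex_of_real (integral\<^sup>L M g) = complex_of_real (integral\<^sup>L M h)"
    using eq[of 0] by (simp add: scaleR_conv_of_real)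
  then have ch: "c = integral\<^sup>L M h"
    by (simp add: c_def)
  show ?thesis
  proof (cases "c = 0")
    case True
    have "AE w in M. g w = 0" "AE w in M. h w = 0"
      using integral_nonneg_eq_0_iff_AE[OF g(1)] integral_nonneg_eq_0_iff_AE[OF h(1)] g(2) h(2)
        True ch by (auto simp: c_def)
    then have "(\<integral>w. g w * indicator A (X w) \<partial>M) = 0" "(\<integral>w. h w * indicator A (Y w) \<partial>M) = 0"
      by (auto intro!: integral_eq_zero_AE)
    then show ?thesis by simp
  next
    case False
    then have c: "c > 0"
      using g(2) by (simp add: c_def less_le)
    have *: "real_distribution (distr (density M (\<lambda>w. f w / c)) borel Z) \<and>
        (\<forall>t. char (distr (density M (\<lambda>w. f w / c)) borel Z) t
          = (CLINT w|M. f w *\<^sub>R iexp (t * Z w)) / c) \<and>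
        measure (distr (density M (\<lambda>w. f w / c)) borel Z) A = (\<integral>w. f w * indicator A (Z w) \<partial>M) / c"
      if f: "integrable M f" "\<And>w. 0 \<le> f w" "c = integral\<^sup>L M f"
        and [measurable]: "Z \<in> borel_measurable M" for f Z :: "'w \<Rightarrow> real"
    proof (intro conjI allI)
      have [measurable]: "f \<in> borel_measurable M" using f by auto
      have "prob_space (density M (\<lambda>w. f w / c))"
      proof
        have "emeasure (density M (\<lambda>w. f w / c)) (space M) = (\<integral>\<^sup>+ w. ennreal (f w / c) \<partial>M)"
          by (simp add: emeasure_density cong: nn_integral_cong)
        also have "\<dots> = ennreal (\<integral>w. f w / c \<partial>M)"
          using f c by (intro nn_integral_eq_integral) auto
        also have "\<dots> = 1" using f c by simp
        finally show "emeasure (density M (\<lambda>w. f w / c)) (space (density M (\<lambda>w. f w / c))) = 1"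
          by simp
      qed
      then interpret D: prob_space "density M (\<lambda>w. f w / c)" .
      show "real_distribution (distr (density M (\<lambda>w. f w / c)) borel Z)"
        by (rule D.real_distribution_distr) simp
      show "char (distr (density M (\<lambda>w. f w / c)) borel Z) t = (CLINT w|M. f w *\<^sub>R iexp (t * Z w)) / c" for t
      proof -
        have "char (distr (density M (\<lambda>w. f w / c)) borel Z) t
            = (CLINT w|M. (f w / c) *\<^sub>R iexp (t * Z w))"
          using f c unfolding char_def by (subst integral_distr) (auto simp: integral_density)
        also have "\<dots> = (CLINT w|M. (f w *\<^sub>R iexp (t * Z w)) / c)"
          by (simp add: scaleR_conv_of_real)
        finally show ?thesis by simp
      qed
      have "measure (distr (density M (\<lambda>w. f w / c)) borel Z) A
          = (\<integral>x. indicator A x \<partial>distr (density M (\<lambda>w. f w / c)) borel Z)"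
        by simp
      also have "\<dots> = (\<integral>w. (f w / c) * indicator A (Z w) \<partial>M)"
        using f c by (subst integral_distr) (auto simp: integral_density)
      also have "\<dots> = (\<integral>w. (f w * indicator A (Z w)) / c \<partial>M)"
        by simp
      finally show "measure (distr (density M (\<lambda>w. f w / c)) borel Z) A
          = (\<integral>w. f w * indicator A (Z w) \<partial>M) / c" by simp
    qed
    have "distr (density M (\<lambda>w. g w / c)) borel X = distr (density M (\<lambda>w. h w / c)) borel Y"
      using *[OF g c_def X] *[OF h ch Y] eq by (intro Levy_uniqueness ext) auto
    then show ?thesis
      using *[OF g c_def X] *[OF h ch Y] c by (auto simp: field_simps)
  qed
qed

text \<open>Trades the exponential in one coordinate for an indicator while the phase of the other
  coordinates survives. The phase \<open>iexp (a w)\<close> is not a nonnegative weight, so it is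
  recovered from the weights \<open>p w * (1 + cos (a w))\<close> and
  \<open>p w * (1 + sin (a w))\<close>, to which \<open>weighted_law_unique\<close> applies.\<close>

lemma phase_weighted_law_unique:
  fixes X Y a b p r :: "'w \<Rightarrow> real"
  assumes "prob_space M"
    and mm [measurable]: "X \<in> borel_measurable M" "Y \<in> borel_measurable M"
      "a \<in> borel_measurable M" "b \<in> borel_measurable M"
      "p \<in> borel_measurable M" "r \<in> borel_measurable M"
    and p: "\<And>w. 0 \<le> p w" "\<And>w. p w \<le> 1" and r: "\<And>w. 0 \<le> r w" "\<And>w. r w \<le> 1"
    and eq: "\<And>t s. (CLINT w|M. p w *\<^sub>R iexp (t * X w + s * a w))
      = (CLINT w|M. r w *\<^sub>R iexp (t * Y w + s * b w))"
    and A [measurable]: "A \<in> sets borel"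
  shows "(CLINT w|M. (p w * indicator A (X w)) *\<^sub>R iexp (a w))
      = (CLINT w|M. (r w * indicator A (Y w)) *\<^sub>R iexp (b w))"
proof -
  interpret prob_space M by fact
  have int: "integrable M (\<lambda>w. f w *\<^sub>R iexp (z w))"
    if "f \<in> borel_measurable M" "z \<in> borel_measurable M" "\<And>w. 0 \<le> f w" "\<And>w. f w \<le> 1"
    for f z :: "'w \<Rightarrow> real"
    using that by (intro integrable_const_bound[where B=1]) auto
  have intr: "integrable M f"
    if "f \<in> borel_measurable M" "\<And>w. \<bar>f w\<bar> \<le> 2"
    for f :: "'w \<Rightarrow> real"
    using that by (intro integrable_const_bound[where B=2]) auto
  have bd: "\<bar>f * x\<bar> \<le> 2" if "0 \<le> f" "f \<le> 1" "\<bar>x\<bar> \<le> 2" for f x :: real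
    using that mult_mono[of f 1 "\<bar>x\<bar>" 2] by (simp add: abs_mult)
  have bd2: "\<bar>f * x * indicator A y\<bar> \<le> 2" if "0 \<le> f" "f \<le> 1" "\<bar>x\<bar> \<le> 2" for f x y :: real
    using bd[OF that] by (simp split: split_indicator)
  have sincos: "\<bar>1 + cos x\<bar> \<le> 2" "\<bar>1 + sin x\<bar> \<le> 2" "\<bar>cos x\<bar> \<le> 2" "\<bar>sin x\<bar> \<le> 2" "0 \<le> 1 + cos x" "0 \<le> 1 + sin x" for x :: real
    using cos_le_one[of x] cos_ge_minus_one[of x] sin_le_one[of x] sin_ge_minus_one[of x]
    by linarith+
  have eq0: "(\<integral>w. p w * indicator A (X w) \<partial>M) = (\<integral>w. r w * indicator A (Y w) \<partial>M)"
    using eq[where s=0] p r by (intro weighted_law_unique intr) (auto intro: order_trans[of _ 1])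
  \<comment> \<open>By Euler's formula the transform under the shifted weight is a combination of
    the given transforms at \<open>s = 0\<close>, \<open>s = 1\<close> and \<open>s = -1\<close>;
    the summand 1 keeps the weight nonnegative.\<close>
  have split_cos: "(CLINT w|M. (f w * (1 + cos (z w))) *\<^sub>R iexp (t * Z w))
      = (CLINT w|M. f w *\<^sub>R iexp (t * Z w + 0 * z w))
        + ((CLINT w|M. f w *\<^sub>R iexp (t * Z w + 1 * z w)) + (CLINT w|M. f w *\<^sub>R iexp (t * Z w + (-1) * z w))) / 2"
    if [measurable]: "f \<in> borel_measurable M" "z \<in> borel_measurable M" "Z \<in> borel_measurable M"
      and f: "\<And>w. 0 \<le> f w" "\<And>w. f w \<le> 1"
    for f z Z :: "'w \<Rightarrow> real" and t
  proof -
    have "(f w * (1 + cos (z w))) *\<^sub>R iexp (t * Z w) = f w *\<^sub>R iexp (t * Z w + 0 * z w)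
        + (f w *\<^sub>R iexp (t * Z w + 1 * z w) + f w *\<^sub>R iexp (t * Z w + (-1) * z w)) / 2" for w
      unfolding cis_conv_exp[symmetric]
      by (simp add: complex_eq_iff cos_add sin_add cos_diff sin_diff algebra_simps)
    moreover have "integrable M (\<lambda>w. f w *\<^sub>R iexp (t * Z w + u * z w))" for u
      using f by (intro int) auto
    note this[of 0] this[of 1] this[of "-1"]
    ultimately show ?thesis
      by simp
  qed
  have split_sin: "(CLINT w|M. (f w * (1 + sin (z w))) *\<^sub>R iexp (t * Z w))
      = (CLINT w|M. f w *\<^sub>R iexp (t * Z w + 0 * z w))
        + ((CLINT w|M. f w *\<^sub>R iexp (t * Z w + 1 * z w)) - (CLINT w|M. f w *\<^sub>R iexp (t * Z w + (-1) * z w))) * (- \<i> / 2)"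
    if [measurable]: "f \<in> borel_measurable M" "z \<in> borel_measurable M" "Z \<in> borel_measurable M"
      and f: "\<And>w. 0 \<le> f w" "\<And>w. f w \<le> 1"
    for f z Z :: "'w \<Rightarrow> real" and t
  proof -
    have "(f w * (1 + sin (z w))) *\<^sub>R iexp (t * Z w) = f w *\<^sub>R iexp (t * Z w + 0 * z w)
        + (f w *\<^sub>R iexp (t * Z w + 1 * z w) - f w *\<^sub>R iexp (t * Z w + (-1) * z w)) * (- \<i> / 2)" for w
      unfolding cis_conv_exp[symmetric]
      by (simp add: complex_eq_iff cos_add sin_add cos_diff sin_diff field_simps)
    moreover have "integrable M (\<lambda>w. f w *\<^sub>R iexp (t * Z w + u * z w))" for u
      using f by (intro int) auto
    note this[of 0] this[of 1] this[of "-1"]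
    ultimately show ?thesis
      by simp
  qed
  have int_cos: "integrable M (\<lambda>w. f w * (1 + cos (z w)))"
    and int_sin: "integrable M (\<lambda>w. f w * (1 + sin (z w)))"
    if [measurable]: "f \<in> borel_measurable M" "z \<in> borel_measurable M"
      and f: "\<And>w. 0 \<le> f w" "\<And>w. f w \<le> 1"
    for f z :: "'w \<Rightarrow> real"
    using f sincos by (intro intr bd; simp)+
  have eq_cos: "(CLINT w|M. (p w * (1 + cos (a w))) *\<^sub>R iexp (t * X w))
      = (CLINT w|M. (r w * (1 + cos (b w))) *\<^sub>R iexp (t * Y w))" for t
    unfolding split_cos[OF mm(5,3,1) p] split_cos[OF mm(6,4,2) r] eq ..
  have c1: "(\<integral>w. (p w * (1 + cos (a w))) * indicator A (X w) \<partial>M)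
      = (\<integral>w. (r w * (1 + cos (b w))) * indicator A (Y w) \<partial>M)"
    by (rule weighted_law_unique[OF mm(1,2) int_cos _ int_cos _ eq_cos A]) (use mm p r sincos in auto)
  have eq_sin: "(CLINT w|M. (p w * (1 + sin (a w))) *\<^sub>R iexp (t * X w))
      = (CLINT w|M. (r w * (1 + sin (b w))) *\<^sub>R iexp (t * Y w))" for t
    unfolding split_sin[OF mm(5,3,1) p] split_sin[OF mm(6,4,2) r] eq ..
  have c2: "(\<integral>w. (p w * (1 + sin (a w))) * indicator A (X w) \<partial>M)
      = (\<integral>w. (r w * (1 + sin (b w))) * indicator A (Y w) \<partial>M)"
    by (rule weighted_law_unique[OF mm(1,2) int_sin _ int_sin _ eq_sin A]) (use mm p r sincos in auto)
  \<comment> \<open>Subtracting the mass already compared in \<open>eq0\<close> leaves the real and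
    imaginary parts of the wanted integral.\<close>
  have c3: "(\<integral>w. (f w * (1 + cos (z w))) * indicator A (Z w) \<partial>M)
      = (\<integral>w. f w * indicator A (Z w) \<partial>M) + Re (CLINT w|M. (f w * indicator A (Z w)) *\<^sub>R iexp (z w))"
    "(\<integral>w. (f w * (1 + sin (z w))) * indicator A (Z w) \<partial>M)
      = (\<integral>w. f w * indicator A (Z w) \<partial>M) + Im (CLINT w|M. (f w * indicator A (Z w)) *\<^sub>R iexp (z w))"
    if [measurable]: "f \<in> borel_measurable M" "z \<in> borel_measurable M" "Z \<in> borel_measurable M"
      and f: "\<And>w. 0 \<le> f w" "\<And>w. f w \<le> 1"
    for f z Z :: "'w \<Rightarrow> real"
  proof -
    have i: "integrable M (\<lambda>w. (f w * indicator A (Z w)) *\<^sub>R iexp (z w))"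
      using f by (intro int) (auto split: split_indicator)
    have i2: "integrable M (\<lambda>w. f w * indicator A (Z w))"
      using f by (intro intr) (auto split: split_indicator intro: order_trans[of _ 1])
    have i3: "integrable M (\<lambda>w. f w * cos (z w) * indicator A (Z w))" "integrable M (\<lambda>w. f w * sin (z w) * indicator A (Z w))"
      using f sincos by (auto intro!: intr bd2)
    show "(\<integral>w. (f w * (1 + cos (z w))) * indicator A (Z w) \<partial>M)
      = (\<integral>w. f w * indicator A (Z w) \<partial>M) + Re (CLINT w|M. (f w * indicator A (Z w)) *\<^sub>R iexp (z w))"
      unfolding integral_Re[OF i, symmetric] using i2 i3
      by (simp add: cis_conv_exp[symmetric] algebra_simps)
    show "(\<integral>w. (f w * (1 + sin (z w))) * indicator A (Z w) \<partial>M)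
      = (\<integral>w. f w * indicator A (Z w) \<partial>M) + Im (CLINT w|M. (f w * indicator A (Z w)) *\<^sub>R iexp (z w))"
      unfolding integral_Im[OF i, symmetric] using i2 i3
      by (simp add: cis_conv_exp[symmetric] algebra_simps)
  qed
  show ?thesis
    using eq0 c1 c2 c3[OF mm(5,3,1) p] c3[OF mm(6,4,2) r] by (simp add: complex_eq_iff)
qed

text \<open>Uniqueness in several dimensions is reduced to one dimension by turning the coordinates
  into indicators one at a time. After the last coordinate the two laws agree on all measurable
  rectangles, which determine a finite measure on the product.\<close>

lemma distr_eqI_char:
  fixes X Y :: "'w \<Rightarrow> nat \<Rightarrow> real"
  assumes "prob_space M"
    and X [measurable]: "\<And>i. i < d \<Longrightarrow> (\<lambda>w. X w i) \<in> borel_measurable M"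
    and Y [measurable]: "\<And>i. i < d \<Longrightarrow> (\<lambda>w. Y w i) \<in> borel_measurable M"
    and eq: "\<And>t. mv_char M d X t = mv_char M d Y t"
  shows "distr M (Pi\<^sub>M {..<d} (\<lambda>_. borel)) (\<lambda>w. restrict (X w) {..<d})
    = distr M (Pi\<^sub>M {..<d} (\<lambda>_. borel)) (\<lambda>w. restrict (Y w) {..<d})"
proof -
  interpret prob_space M by fact
  \<comment> \<open>Coordinates below \<open>n\<close> have already become indicators; those from
    \<open>n\<close> on still enter through the exponential. All \<open>t\<close> are quantified
    inside the induction, since the step uses other frequencies.\<close>
  have main: "\<forall>t. (CLINT w|M. (\<Prod>i<n. indicator (B i) (X w i)) *\<^sub>R iexp (\<Sum>i\<in>{n..<d}. t i * X w i))
      = (CLINT w|M. (\<Prod>i<n. indicator (B i) (Y w i)) *\<^sub>R iexp (\<Sum>i\<in>{n..<d}. t i * Y w i))"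
    if "n \<le> d" and B: "\<And>i. i < d \<Longrightarrow> B i \<in> sets borel" for n and B :: "nat \<Rightarrow> real set"
    using that(1)
  proof (induction n)
    case 0
    show ?case using eq by (simp add: mv_char_def atLeast0LessThan)
  next
    case (Suc n)
    have [measurable]: "B i \<in> sets borel" if "i < d" for i by (rule B) fact
    show ?case
    proof
      fix t
      \<comment> \<open>Coordinate \<open>n\<close> gets its own frequency \<open>u\<close> and the
        later ones the common factor \<open>s\<close>: this is the two-parameter family that
        \<open>phase_weighted_law_unique\<close> asks for.\<close>
      have "(CLINT w|M. (\<Prod>i<n. indicator (B i) (X w i)) *\<^sub>R iexp (u * X w n + s * (\<Sum>i\<in>{Suc n..<d}. t i * X w i)))
        = (CLINT w|M. (\<Prod>i<n. indicator (B i) (Y w i)) *\<^sub>R iexp (u * Y w n + s * (\<Sum>i\<in>{Suc n..<d}. t i * Y w i)))"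
        for u s
      proof -
        have "u * x n + s * (\<Sum>i\<in>{Suc n..<d}. t i * x i)
            = (\<Sum>i\<in>{n..<d}. (if i = n then u else s * t i) * x i)" for x :: "nat \<Rightarrow> real"
          using Suc.prems by (simp add: sum.atLeast_Suc_lessThan sum_distrib_left mult.assoc)
        then show ?thesis using Suc by simp
      qed
      then show "(CLINT w|M. (\<Prod>i<Suc n. indicator (B i) (X w i)) *\<^sub>R iexp (\<Sum>i\<in>{Suc n..<d}. t i * X w i))
        = (CLINT w|M. (\<Prod>i<Suc n. indicator (B i) (Y w i)) *\<^sub>R iexp (\<Sum>i\<in>{Suc n..<d}. t i * Y w i))"
        unfolding prod.lessThan_Suc using Suc.prems
        by (intro phase_weighted_law_unique \<open>prob_space M\<close>)
           (auto intro!: prod_nonneg prod_le_1 borel_measurable_prod borel_measurable_sum)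
    qed
  qed
  have mX: "(\<lambda>w. restrict (Z w) {..<d}) \<in> measurable M (Pi\<^sub>M {..<d} (\<lambda>_. borel))"
    if "\<And>i. i < d \<Longrightarrow> (\<lambda>w. Z w i) \<in> borel_measurable M" for Z :: "'w \<Rightarrow> nat \<Rightarrow> real"
    using that by (intro measurable_restrict) auto
  show ?thesis
  proof (rule measure_eqI_PiM_finite[where A="\<lambda>_::nat. \<Pi>\<^sub>E i\<in>{..<d}. UNIV"])
    fix B :: "nat \<Rightarrow> real set" assume B: "\<And>i. i \<in> {..<d} \<Longrightarrow> B i \<in> sets borel"
    have rect: "emeasure (distr M (Pi\<^sub>M {..<d} (\<lambda>_. borel)) (\<lambda>w. restrict (Z w) {..<d})) (Pi\<^sub>E {..<d} B)
        = ennreal (\<integral>w. (\<Prod>i<d. indicator (B i) (Z w i)) \<partial>M)"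
      if Z: "\<And>i. i < d \<Longrightarrow> (\<lambda>w. Z w i) \<in> borel_measurable M" for Z :: "'w \<Rightarrow> nat \<Rightarrow> real"
    proof -
      have "emeasure (distr M (Pi\<^sub>M {..<d} (\<lambda>_. borel)) (\<lambda>w. restrict (Z w) {..<d})) (Pi\<^sub>E {..<d} B)
          = emeasure M ((\<lambda>w. restrict (Z w) {..<d}) -` (Pi\<^sub>E {..<d} B) \<inter> space M)" (is "_ = emeasure M ?S")
        using B by (intro emeasure_distr mX Z sets_PiM_I_finite) auto
      moreover have "(\<integral>w. (\<Prod>i<d. indicator (B i) (Z w i)) \<partial>M) = integral\<^sup>L M (indicator ?S :: _ \<Rightarrow> real)"
      proof (rule Bochner_Integration.integral_cong[OF refl])
        fix w assume "w \<in> space M"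
        show "(\<Prod>i<d. indicator (B i) (Z w i)) = (indicator ?S w :: real)" (is "?l = ?r")
        proof (cases "\<forall>i<d. Z w i \<in> B i")
          case True
          with \<open>w \<in> space M\<close> show "?l = ?r" by (simp add: PiE_iff)
        next
          case False
          then have "(\<Prod>i<d. indicator (B i) (Z w i)) = (0 :: real)"
            by (intro prod_zero) (auto simp: indicator_def)
          moreover have "w \<notin> ?S" using False by (auto simp: PiE_iff)
          ultimately show "?l = ?r" by simp
        qed
      qed
      ultimately show ?thesis
        by (simp add: emeasure_eq_measure Int_absorb2)
    qed
    have "complex_of_real (\<integral>w. (\<Prod>i<d. indicator (B i) (X w i)) \<partial>M)
        = complex_of_real (\<integral>w. (\<Prod>i<d. indicator (B i) (Y w i)) \<partial>M)"
      using main[of d B] B by (simp add: scaleR_conv_of_real del: of_real_prod)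
    then show "emeasure (distr M (Pi\<^sub>M {..<d} (\<lambda>_. borel)) (\<lambda>w. restrict (X w) {..<d})) (Pi\<^sub>E {..<d} B)
      = emeasure (distr M (Pi\<^sub>M {..<d} (\<lambda>_. borel)) (\<lambda>w. restrict (Y w) {..<d})) (Pi\<^sub>E {..<d} B)"
      using rect[OF X] rect[OF Y] by simp
  next
    show "range (\<lambda>_::nat. \<Pi>\<^sub>E i\<in>{..<d}. UNIV) \<subseteq> prod_algebra {..<d} (\<lambda>_. borel)"
      by (auto intro!: prod_algebraI_finite)
    interpret D: prob_space "distr M (Pi\<^sub>M {..<d} (\<lambda>_. borel)) (\<lambda>w. restrict (X w) {..<d})"
      by (rule prob_space_distr) (rule mX[OF X])
    show "emeasure (distr M (Pi\<^sub>M {..<d} (\<lambda>_. borel)) (\<lambda>w. restrict (X w) {..<d})) (\<Pi>\<^sub>E i\<in>{..<d}. UNIV) \<noteq> \<infinity>"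
      by simp
  qed (auto simp: space_PiM)
qed

section \<open>Compact positive operators\<close>

lemma midpoint_parallelogram:
  fixes a b :: "'a::real_inner"
  shows "(norm (a - b))\<^sup>2 = 2 * (norm a)\<^sup>2 + 2 * (norm b)\<^sup>2 - 4 * (norm ((1/2) *\<^sub>R (a + b)))\<^sup>2"
  by (simp add: power2_norm_eq_inner inner_add inner_diff algebra_simps inner_commute)

text \<open>The projection theorem: for \<open>x\<close> outside \<open>T\<close>, the
  near-minimisers of the distance to \<open>x\<close> form nested closed sets whose diameters tend
  to zero, so completeness yields a nearest point \<open>p\<close>, and \<open>x - p\<close> is
  orthogonal to \<open>T\<close>.\<close>

lemma ex_nonzero_orthogonal:
  fixes T :: "'a::{real_inner, banach} set"
  assumes T: "subspace T" "closed T" and "T \<noteq> UNIV"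
  shows "\<exists>z. z \<noteq> 0 \<and> (\<forall>y\<in>T. z \<bullet> y = 0)"
proof -
  obtain x where x: "x \<notin> T" using assms(3) by auto
  have T0: "T \<noteq> {}" using subspace_0[OF T(1)] by auto
  define r where "r = infdist x T"
  have r0: "r \<ge> 0" by (simp add: r_def infdist_nonneg)
  have rle: "r \<le> norm (x - y)" if "y \<in> T" for y
    using infdist_le[OF that, of x] by (simp add: r_def dist_norm)
  define S where "S n = {y\<in>T. norm (x - y) \<le> r + inverse (Suc n)}" for n
  \<comment> \<open>The midpoint of two near-minimisers lies in \<open>T\<close> and is at least
    \<open>r\<close> away from \<open>x\<close>, so the parallelogram identity bounds their distance
    by the slack.\<close>
  have close: "(norm (y - z))\<^sup>2 \<le> 4 * (2 * r + 1) * inverse (Suc n)" if "y \<in> S n" "z \<in> S n" for y z n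
  proof -
    have i: "0 \<le> inverse (real (Suc n))" "inverse (real (Suc n)) \<le> 1" by (auto simp: field_simps)
    have "(1/2) *\<^sub>R (y + z) \<in> T"
      using that T by (auto simp: S_def intro!: subspace_scale subspace_add)
    then have "r \<le> norm (x - (1/2) *\<^sub>R (y + z))" by (rule rle)
    also have "x - (1/2) *\<^sub>R (y + z) = (1/2) *\<^sub>R ((x - y) + (x - z))"
      by (simp add: algebra_simps flip: scaleR_add_left)
    finally have "r\<^sup>2 \<le> (norm ((1/2) *\<^sub>R ((x - y) + (x - z))))\<^sup>2"
      using r0 by (rule power_mono)
    moreover have "(norm (x - y))\<^sup>2 \<le> (r + inverse (Suc n))\<^sup>2" "(norm (x - z))\<^sup>2 \<le> (r + inverse (Suc n))\<^sup>2"
      using that by (auto simp: S_def intro!: power_mono)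
    ultimately have "(norm ((x - y) - (x - z)))\<^sup>2 \<le> 4 * (r + inverse (Suc n))\<^sup>2 - 4 * r\<^sup>2"
      unfolding midpoint_parallelogram[of "x - y" "x - z"] by linarith
    also have "\<dots> = 4 * (2 * r + inverse (Suc n)) * inverse (Suc n)"
      by (simp add: power2_eq_square algebra_simps)
    also have "\<dots> \<le> 4 * (2 * r + 1) * inverse (Suc n)"
      using i by (intro mult_right_mono) auto
    finally show ?thesis by (simp add: norm_minus_commute)
  qed
  have "\<exists>p. p \<in> (\<Inter>n. S n)"
  proof (rule decreasing_closed_nest)
    show "closed (S n)" for n
    proof -
      have "S n = T \<inter> cball x (r + inverse (Suc n))" by (auto simp: S_def dist_norm)
      then show ?thesis using T by (auto intro: closed_Int)
    qed
    show "S n \<noteq> {}" for n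
    proof -
      have "(INF y\<in>T. dist x y) < r + inverse (Suc n)" using T0 by (simp add: r_def infdist_notempty)
      then obtain y where "y \<in> T" "dist x y < r + inverse (Suc n)"
        using cINF_less_iff[OF T0, of "dist x"] by (auto intro: bdd_belowI2[where m=0])
      then show ?thesis by (auto simp: S_def dist_norm intro: less_imp_le)
    qed
    show "S n \<subseteq> S m" if "m \<le> n" for m n
    proof -
      have "inverse (real (Suc n)) \<le> inverse (real (Suc m))" using that by (simp add: field_simps)
      then have "z \<le> r + inverse (Suc n) \<Longrightarrow> z \<le> r + inverse (Suc m)" for z by linarith
      then show ?thesis unfolding S_def by blast
    qed
    show "\<exists>n. \<forall>x\<in>S n. \<forall>y\<in>S n. dist x y < e" if "e > 0" for e :: real
    proof -
      obtain n where "inverse (real (Suc n)) < e\<^sup>2 / (4 * (2 * r + 1))"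
        using reals_Archimedean[of "e\<^sup>2 / (4 * (2 * r + 1))"] \<open>e > 0\<close> r0 by auto
      then have n: "4 * (2 * r + 1) * inverse (Suc n) < e\<^sup>2" using r0 by (simp add: field_simps)
      have "dist y z < e" if "y \<in> S n" "z \<in> S n" for y z
        using close[OF that] n \<open>e > 0\<close> by (intro power2_less_imp_less[of _ e]) (auto simp: dist_norm)
      then show ?thesis by blast
    qed
  qed auto
  then obtain p where p: "\<And>n. p \<in> S n" by auto
  have pT: "p \<in> T" using p by (auto simp: S_def)
  have pr: "norm (x - p) \<le> r"
  proof (rule field_le_epsilon)
    fix e :: real assume "e > 0"
    then obtain n where "inverse (real (Suc n)) < e" using reals_Archimedean by blast
    then show "norm (x - p) \<le> r + e" using p[of n] by (auto simp: S_def)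
  qed
  have "(x - p) \<bullet> y = 0" if y: "y \<in> T" for y
  proof (cases "y = 0")
    case False
    \<comment> \<open>The step along \<open>y\<close> that shortens \<open>x - p\<close> most; since
      \<open>p\<close> is nearest, it cannot shorten it at all.\<close>
    define s where "s = ((x - p) \<bullet> y) / (y \<bullet> y)"
    have "p + s *\<^sub>R y \<in> T" using T pT y by (intro subspace_add subspace_scale)
    then have "norm (x - p) \<le> norm (x - (p + s *\<^sub>R y))" using rle pr by fastforce
    then have "(norm (x - p))\<^sup>2 \<le> (norm ((x - p) - s *\<^sub>R y))\<^sup>2"
      by (intro power_mono) (auto simp: algebra_simps)
    then have "2 * s * ((x - p) \<bullet> y) \<le> s * s * (y \<bullet> y)"
      unfolding power2_norm_eq_inner by (simp add: inner_diff inner_commute algebra_simps)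
    also have "\<dots> = s * ((x - p) \<bullet> y)" using False by (simp add: s_def)
    finally have "((x - p) \<bullet> y)\<^sup>2 / (y \<bullet> y) \<le> 0" by (simp add: s_def power2_eq_square)
    moreover have "y \<bullet> y > 0" using False by simp
    ultimately have "((x - p) \<bullet> y)\<^sup>2 \<le> 0"
      by (simp add: divide_le_0_iff)
    then show ?thesis by simp
  qed simp
  moreover have "x - p \<noteq> 0" using x pT by auto
  ultimately show ?thesis by blast
qed

lemma orthogonal_to_span_zero:
  fixes x :: "'a::real_inner"
  assumes "\<And>b. b \<in> B \<Longrightarrow> x \<bullet> b = 0" "y \<in> span B"
  shows "x \<bullet> y = 0"
  using assms(2) by (rule span_induct) (auto simp: subspace_def inner_add_right assms(1))

text \<open>Gram-Schmidt by induction: a new vector \<open>a\<close> contributes only its part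
  \<open>r\<close> orthogonal to the old span, and the old residual of \<open>x\<close> then loses
  its component along \<open>r\<close>.\<close>

lemma finite_span_decomposition:
  fixes F :: "'a::real_inner set"
  assumes "finite F"
  obtains p r where "x = p + r" "p \<in> span F" "\<And>y. y \<in> span F \<Longrightarrow> r \<bullet> y = 0"
  using assms
proof (induction F arbitrary: thesis x rule: finite_induct)
  case empty
  show ?case by (rule empty[of 0 x]) auto
next
  case (insert a F)
  obtain p r where a: "a = p + r" "p \<in> span F" "\<And>y. y \<in> span F \<Longrightarrow> r \<bullet> y = 0"
    using insert.IH[of a] by metis
  obtain p' r' where x: "x = p' + r'" "p' \<in> span F" "\<And>y. y \<in> span F \<Longrightarrow> r' \<bullet> y = 0"
    using insert.IH[of x] by metis
  \<comment> \<open>If \<open>r = 0\<close>, division by zero makes \<open>s = 0\<close> and nothing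
    is corrected.\<close>
  define s where "s = (r' \<bullet> r) / (r \<bullet> r)"
  have rin: "r \<in> span (insert a F)"
  proof -
    have "a - p \<in> span (insert a F)"
      using a(2) span_mono[of F "insert a F"] by (intro span_diff) (auto intro: span_base)
    then show ?thesis using a(1) by simp
  qed
  show ?case
  proof (rule insert.prems[of "p' + s *\<^sub>R r" "r' - s *\<^sub>R r"])
    show "x = p' + s *\<^sub>R r + (r' - s *\<^sub>R r)" using x(1) by simp
    show "p' + s *\<^sub>R r \<in> span (insert a F)"
      using x(2) rin span_mono[of F "insert a F"] by (intro span_add span_scale) auto
    have rr: "(r' - s *\<^sub>R r) \<bullet> r = 0"
      by (cases "r = 0") (auto simp: s_def inner_diff_left)
    fix y assume y: "y \<in> span (insert a F)"
    have F: "(r' - s *\<^sub>R r) \<bullet> z = 0" if "z \<in> span F" for z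
      using a(3) x(3) that by (simp add: inner_diff_left)
    show "(r' - s *\<^sub>R r) \<bullet> y = 0"
      using y
    proof (rule orthogonal_to_span_zero[rotated])
      fix b assume b: "b \<in> insert a F"
      have "(r' - s *\<^sub>R r) \<bullet> (p + r) = 0"
        using F[OF a(2)] rr by (simp only: inner_add_right)
      then show "(r' - s *\<^sub>R r) \<bullet> b = 0"
        using b F[OF span_base] a(1) by (cases "b = a") simp_all
    qed
  qed
qed

section \<open>Eigenvectors of compact positive operators\<close>

text \<open>The quadratic polynomial
  \<open>G (x + t *\<^sub>R y) \<bullet> (x + t *\<^sub>R y)\<close> in \<open>t\<close> is
  nonnegative. Its value at the minimiser gives the inequality; if the leading coefficient vanishes,
  the linear one must vanish too.\<close>

lemma psd_Cauchy_Schwarz: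
  fixes G :: "'a::real_inner \<Rightarrow> 'a"
  assumes "bounded_linear G" "selfadjoint_operator G" "psd_operator G"
  shows "(G x \<bullet> y)\<^sup>2 \<le> (G x \<bullet> x) * (G y \<bullet> y)"
proof -
  interpret bounded_linear G by fact
  have "0 \<le> (G x \<bullet> x) + 2 * t * (G x \<bullet> y) + t\<^sup>2 * (G y \<bullet> y)" for t
  proof -
    have "0 \<le> G (x + t *\<^sub>R y) \<bullet> (x + t *\<^sub>R y)" using assms(3) by (simp add: psd_operator_def)
    moreover have "G y \<bullet> x = G x \<bullet> y" using assms(2) by (metis selfadjoint_operator_def inner_commute)
    ultimately show ?thesis
      by (simp add: add scaleR inner_add algebra_simps power2_eq_square)
  qed
  note pos = this
  show ?thesis
  proof (cases "G y \<bullet> y = 0")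
    case True
    have "G x \<bullet> y = 0"
    proof (rule ccontr)
      assume "G x \<bullet> y \<noteq> 0"
      then show False
        \<comment> \<open>At this \<open>t\<close> the polynomial, now affine, would take the value
          -1.\<close>
        using pos[of "- (G x \<bullet> x + 1) / (2 * (G x \<bullet> y))"] True by (simp add: field_simps)
    qed
    then show ?thesis using True by simp
  next
    case False
    moreover have "0 \<le> G y \<bullet> y" using assms(3) by (simp add: psd_operator_def)
    ultimately show ?thesis
      using pos[of "- (G x \<bullet> y) / (G y \<bullet> y)"] by (simp add: power2_eq_square field_simps)
  qed
qed

text \<open>The supremum \<open>m\<close> of the Rayleigh quotient on the unit sphere of
  \<open>S\<close> is attained. For a maximising sequence, \<open>G (X n) - m *\<^sub>R X n\<close>
  tends to zero; compactness makes the images converge along a subsequence, and for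
  \<open>m > 0\<close> the vectors themselves then converge to an eigenvector. If
  \<open>m = 0\<close>, then \<open>G\<close> vanishes on \<open>S\<close>.\<close>

lemma ex_eigenfunction_subspace:
  fixes G :: "'a::real_inner \<Rightarrow> 'a"
  assumes comp: "compact_operator G" and sa: "selfadjoint_operator G" and psd: "psd_operator G"
    and S: "subspace S" "closed S" "S \<noteq> {0}" and inv: "G ` S \<subseteq> S"
  shows "\<exists>e l. e \<in> S \<and> norm e = 1 \<and> eigenfunction G l e"
proof -
  have bl: "bounded_linear G" using comp by (simp add: compact_operator_def)
  interpret bounded_linear G by fact
  define U where "U = {x\<in>S. norm x = 1}"
  have "0 \<in> S" using S by (simp add: subspace_0)
  then obtain x0 where x0: "x0 \<in> S" "x0 \<noteq> 0" using S by auto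
  have sgnU: "(1 / norm x) *\<^sub>R x \<in> U" if "x \<in> S" "x \<noteq> 0" for x
    using that S by (auto simp: U_def subspace_scale)
  have U0: "U \<noteq> {}" using sgnU[OF x0] by auto
  obtain K where K: "\<And>x. norm (G x) \<le> norm x * K" using bounded by blast
  define m where "m = (SUP x\<in>U. G x \<bullet> x)"
  have bdd: "bdd_above ((\<lambda>x. G x \<bullet> x) ` U)"
  proof (rule bdd_aboveI2)
    fix x assume "x \<in> U"
    then show "G x \<bullet> x \<le> K"
      using norm_cauchy_schwarz[of "G x" x] K[of x] by (simp add: U_def)
  qed
  have up: "G x \<bullet> x \<le> m" if "x \<in> U" for x
    unfolding m_def using that bdd by (rule cSUP_upper)
  have upS: "G x \<bullet> x \<le> m * (norm x)\<^sup>2" if "x \<in> S" for x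
  proof (cases "x = 0")
    case False
    show ?thesis
      using up[OF sgnU[OF that False]] False by (simp add: scaleR power2_eq_square field_simps)
  qed (simp add: zero)
  have m0: "m \<ge> 0"
  proof -
    obtain x where "x \<in> U" using U0 by auto
    then show ?thesis
      using up[of x] psd unfolding psd_operator_def by (meson order_trans)
  qed
  \<comment> \<open>Cauchy-Schwarz for the form of \<open>G\<close>, applied to \<open>x\<close> and
    \<open>G x\<close>. For unit \<open>x\<close> it yields \<open>(norm (G x - m *\<^sub>R
    x))\<^sup>2 \<le> m * (m - G x \<bullet> x)\<close>, which drives the limit below.\<close>
  have GS: "(norm (G x))\<^sup>2 \<le> m * (G x \<bullet> x)" if "x \<in> S" for x
  proof (cases "G x = 0")
    case False
    have "(G x \<bullet> G x)\<^sup>2 \<le> (G x \<bullet> x) * (G (G x) \<bullet> G x)"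
      by (rule psd_Cauchy_Schwarz[OF bl sa psd])
    also have "\<dots> \<le> (G x \<bullet> x) * (m * (norm (G x))\<^sup>2)"
      using psd that inv by (intro mult_left_mono upS) (auto simp: psd_operator_def)
    finally have "(norm (G x))\<^sup>2 * (norm (G x))\<^sup>2 \<le> (m * (G x \<bullet> x)) * (norm (G x))\<^sup>2"
      by (simp add: dot_square_norm power2_eq_square mult_ac)
    then show ?thesis
      by (rule mult_right_le_imp_le) (use False in simp)
  qed (use psd m0 in \<open>simp\<close>)
  show ?thesis
  proof (cases "m = 0")
    case True
    obtain e where e: "e \<in> U" using U0 by auto
    then have "G e = 0" using GS[of e] True by (simp add: U_def)
    then have "eigenfunction G 0 e" using e by (auto simp: eigenfunction_def U_def)
    then show ?thesis using e by (auto simp: U_def)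
  next
    case False
    then have m: "m > 0" using m0 by simp
    have "\<exists>x\<in>U. m - inverse (Suc n) < G x \<bullet> x" for n
      using less_cSUP_iff[OF U0 bdd, of "m - inverse (Suc n)"] by (simp flip: m_def)
    then obtain X where X: "\<And>n. X n \<in> U" "\<And>n. m - inverse (Suc n) < G (X n) \<bullet> X n" by metis
    have lim: "(\<lambda>n. G (X n) - m *\<^sub>R X n) \<longlonglongrightarrow> 0"
    proof -
      have b: "(norm (G (X n) - m *\<^sub>R X n))\<^sup>2 \<le> m * inverse (Suc n)" for n
      proof -
        have n1: "X n \<bullet> X n = 1" using X(1)[of n] by (simp add: U_def norm_eq_1)
        have "(norm (G (X n) - m *\<^sub>R X n))\<^sup>2 = (norm (G (X n)))\<^sup>2 - 2 * m * (G (X n) \<bullet> X n) + m * m"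
          unfolding power2_norm_eq_inner using n1
          by (simp add: inner_diff inner_commute algebra_simps)
        also have "\<dots> \<le> m * (m - G (X n) \<bullet> X n)"
          using GS[of "X n"] X(1)[of n] by (simp add: U_def algebra_simps)
        also have "\<dots> \<le> m * inverse (Suc n)"
          using X(2)[of n] m by (intro mult_left_mono) auto
        finally show ?thesis .
      qed
      have "(\<lambda>n. (norm (G (X n) - m *\<^sub>R X n))\<^sup>2) \<longlonglongrightarrow> 0"
      proof (rule tendsto_sandwich[OF _ _ tendsto_const])
        show "(\<lambda>n. m * inverse (real (Suc n))) \<longlonglongrightarrow> 0"
          using tendsto_mult[OF tendsto_const LIMSEQ_inverse_real_of_nat, of m] by simp
      qed (use b in auto)
      then have "(\<lambda>n. norm (G (X n) - m *\<^sub>R X n)) \<longlonglongrightarrow> 0"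
        by (subst (asm) power_tendsto_0_iff) auto
      then show ?thesis by (rule tendsto_norm_zero_cancel)
    qed
    have "seq_compact (closure (G ` cball 0 1))"
      using comp by (simp add: compact_operator_def compact_imp_seq_compact)
    moreover have "\<forall>n. G (X n) \<in> closure (G ` cball 0 1)"
      using X(1) closure_subset[of "G ` cball 0 1"] by (force simp: U_def)
    ultimately obtain z f where f: "strict_mono (f :: nat \<Rightarrow> nat)" "((\<lambda>n. G (X n)) \<circ> f) \<longlonglongrightarrow> z"
      by (rule seq_compactE)
    have "(\<lambda>n. G (X (f n)) - (G (X (f n)) - m *\<^sub>R X (f n))) \<longlonglongrightarrow> z - 0"
      using f LIMSEQ_subseq_LIMSEQ[OF lim f(1)] by (intro tendsto_diff) (auto simp: o_def)
    then have mX: "(\<lambda>n. (1/m) *\<^sub>R (m *\<^sub>R X (f n))) \<longlonglongrightarrow> (1/m) *\<^sub>R z"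
      by (intro tendsto_scaleR tendsto_const) simp
    define e where "e = (1/m) *\<^sub>R z"
    have Xe: "(\<lambda>n. X (f n)) \<longlonglongrightarrow> e" using mX m by (simp add: e_def)
    have "e \<in> S"
      using S(2) X(1) Xe by (rule_tac closed_sequentially[of S "\<lambda>n. X (f n)"]) (auto simp: U_def)
    moreover have ne: "norm e = 1"
      using tendsto_norm[OF Xe] X(1) by (auto simp: U_def LIMSEQ_const_iff)
    moreover have "G e = z"
      using tendsto[OF Xe] f(2) by (intro LIMSEQ_unique) (auto simp: o_def)
    then have "G e = m *\<^sub>R e" using m by (simp add: e_def)
    ultimately show ?thesis by (auto simp: eigenfunction_def)
  qed
qed

text \<open>Zorn's lemma gives a maximal orthonormal system of eigenvectors in \<open>S\<close>. Its
  complement in \<open>S\<close> is closed and, by self-adjointness, invariant, so if nonzero it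
  would contain another eigenvector. The subspace \<open>S\<close> is a parameter because the span
  of the points and its orthogonal complement are diagonalised separately.\<close>

lemma ex_maximal_orthonormal_eigenfunctions:
  fixes G :: "'a::real_inner \<Rightarrow> 'a"
  assumes comp: "compact_operator G" and sa: "selfadjoint_operator G" and psd: "psd_operator G"
    and S: "subspace S" "closed S" and inv: "G ` S \<subseteq> S"
  obtains B where "B \<subseteq> S" "\<forall>e\<in>B. norm e = 1" "pairwise orthogonal B"
    "\<forall>e\<in>B. \<exists>l. eigenfunction G l e"
    "\<And>x. \<lbrakk>x \<in> S; \<And>b. b \<in> B \<Longrightarrow> x \<bullet> b = 0\<rbrakk> \<Longrightarrow> x = 0"
proof -
  define \<B> where "\<B> = {B. B \<subseteq> S \<and> (\<forall>e\<in>B. norm e = 1) \<and> pairwise orthogonal B \<and>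
    (\<forall>e\<in>B. \<exists>l. eigenfunction G l e)}"
  have "\<exists>M\<in>\<B>. \<forall>X\<in>\<B>. M \<subseteq> X \<longrightarrow> X = M"
  proof (rule subset_Zorn')
    fix C assume C: "subset.chain \<B> C"
    then have CB: "C \<subseteq> \<B>" and lin: "\<forall>X\<in>C. \<forall>Y\<in>C. X \<subseteq> Y \<or> Y \<subseteq> X"
      unfolding subset_chain_def by simp_all
    have "pairwise orthogonal (\<Union>C)"
      using CB lin by (intro pairwise_chain_Union) (auto simp only: \<B>_def chain_subset_def)
    then show "\<Union>C \<in> \<B>"
      using CB unfolding \<B>_def by blast
  qed
  then obtain B where B: "B \<in> \<B>" and max: "\<And>X. X \<in> \<B> \<Longrightarrow> B \<subseteq> X \<Longrightarrow> X = B" by blast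
  define T where "T = S \<inter> (\<Inter>b\<in>B. {x. b \<bullet> x = 0})"
  have "T = {0}"
  proof (rule ccontr)
    assume T0: "T \<noteq> {0}"
    have "subspace T" unfolding T_def
      by (intro subspace_inter S subspace_Inter) (auto simp: subspace_hyperplane)
    moreover have "closed T" unfolding T_def
      by (intro closed_Int S closed_INT) (auto simp: closed_hyperplane)
    moreover have "G ` T \<subseteq> T"
    proof (rule image_subsetI)
      fix x assume x: "x \<in> T"
      have "b \<bullet> G x = 0" if b: "b \<in> B" for b
      proof -
        obtain l where "G b = l *\<^sub>R b" using B b by (auto simp: \<B>_def eigenfunction_def)
        then have "G b \<bullet> x = 0" using x b by (simp add: T_def)
        then show ?thesis using sa by (simp add: selfadjoint_operator_def)
      qed
      then show "G x \<in> T" using x inv by (auto simp: T_def)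
    qed
    ultimately obtain e l where e: "e \<in> T" "norm e = 1" "eigenfunction G l e"
      using ex_eigenfunction_subspace[OF comp sa psd _ _ T0] by blast
    have "insert e B \<in> \<B>"
      using B e by (auto simp: \<B>_def T_def pairwise_insert orthogonal_def inner_commute)
    then have "e \<in> B" using max[of "insert e B"] by auto
    then have "e \<bullet> e = 0" using e by (auto simp: T_def)
    then show False using e by auto
  qed
  then have "x = 0" if "x \<in> S" "\<And>b. b \<in> B \<Longrightarrow> x \<bullet> b = 0" for x
    using that by (auto simp: T_def inner_commute)
  then show ?thesis
    using B by (intro that[of B]) (simp_all add: \<B>_def)
qed

section \<open>Finite-dimensional invariant subspaces and leading eigenfunctions\<close>

lemma subspace_closure:
  fixes S :: "'a::real_normed_vector set"
  assumes "subspace S"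
  shows "subspace (closure S)"
  unfolding subspace_def closure_sequential
proof (intro conjI allI ballI impI; (elim exE conjE)?)
  show "\<exists>x. (\<forall>n. x n \<in> S) \<and> x \<longlonglongrightarrow> 0"
    using assms by (intro exI[of _ "\<lambda>_. 0"]) (simp add: subspace_0)
next
  fix x y assume "x \<in> closure S" "y \<in> closure S"
  then obtain X Y where "\<forall>n. X n \<in> S" "X \<longlonglongrightarrow> x" "\<forall>n. Y n \<in> S" "Y \<longlonglongrightarrow> y"
    unfolding closure_sequential by blast
  then show "\<exists>z. (\<forall>n. z n \<in> S) \<and> z \<longlonglongrightarrow> x + y"
    using assms by (intro exI[of _ "\<lambda>n. X n + Y n"]) (auto intro: tendsto_add subspace_add)
next
  fix c x assume "x \<in> closure S"
  then obtain X where "\<forall>n. X n \<in> S" "X \<longlonglongrightarrow> x"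
    unfolding closure_sequential by blast
  then show "\<exists>z. (\<forall>n. z n \<in> S) \<and> z \<longlonglongrightarrow> c *\<^sub>R x"
    using assms by (intro exI[of _ "\<lambda>n. c *\<^sub>R X n"]) (auto intro: tendsto_scaleR subspace_scale)
qed

lemma closed_span_finite:
  fixes F :: "'a::real_inner set"
  assumes "finite F"
  shows "closed (span F)"
proof -
  have "x \<in> span F" if x: "x \<in> closure (span F)" for x
  proof -
    obtain p r where pr: "x = p + r" "p \<in> span F" "\<And>y. y \<in> span F \<Longrightarrow> r \<bullet> y = 0"
      using finite_span_decomposition[OF assms] by metis
    have "closure (span F) \<subseteq> {y. r \<bullet> y = 0}"
      using pr(3) by (intro closure_minimal) (auto simp: closed_hyperplane)
    then have "r \<bullet> x = 0" using x by auto
    then have "r \<bullet> r = 0" using pr by (simp add: inner_add_right)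
    then show ?thesis using pr by simp
  qed
  then have "closure (span F) = span F" using closure_subset by blast
  then show ?thesis by (metis closed_closure)
qed

text \<open>The hypothesis places the orthogonal complement of the image inside that of the span, so
  the span lies in its own image; the image has no larger dimension, hence the two coincide.\<close>

lemma invariant_if_orthogonal_image:
  fixes G :: "'a::real_inner \<Rightarrow> 'a"
  assumes "linear G" "finite F"
    and orth: "\<And>u. (\<And>w. w \<in> span F \<Longrightarrow> u \<bullet> G w = 0) \<Longrightarrow> (\<And>w. w \<in> span F \<Longrightarrow> u \<bullet> w = 0)"
  shows "G ` span F \<subseteq> span F"
proof -
  interpret linear G by fact
  obtain B where B: "B \<subseteq> F" "independent B" "span B = span F"
    using maximal_independent_subset[of F] span_superset[of F]
    by (metis span_subspace subspace_span span_minimal subset_trans subset_antisym span_mono)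
  have finB: "finite B" using B assms(2) finite_subset by blast
  have sp: "span F \<subseteq> span (G ` B)"
  proof
    fix x assume x: "x \<in> span F"
    obtain p r where pr: "x = p + r" "p \<in> span (G ` B)" "\<And>y. y \<in> span (G ` B) \<Longrightarrow> r \<bullet> y = 0"
      using finite_span_decomposition[of "G ` B" x] finB by blast
    have "r \<bullet> G w = 0" if "w \<in> span F" for w
      using pr(3)[of "G w"] that B(3) by (simp add: linear_span_image[OF assms(1)])
    then have "r \<bullet> x = 0" using orth x by blast
    then have "r \<bullet> r = 0" using pr by (simp add: inner_add_right)
    then show "x \<in> span (G ` B)" using pr by simp
  qed
  \<comment> \<open>An image outside \<open>span B\<close> would give \<open>card B + 1\<close>
    independent vectors in the span of at most \<open>card B\<close> vectors.\<close>
  have "G ` B \<subseteq> span B"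
  proof (rule ccontr)
    assume "\<not> G ` B \<subseteq> span B"
    then obtain c where c: "c \<in> G ` B" "c \<notin> span B" by auto
    then have "independent (insert c B)" "c \<notin> B"
      using B(2) by (auto simp: independent_insert span_base)
    moreover have "insert c B \<subseteq> span (G ` B)"
      using c sp B(3) span_superset[of B] by (auto simp: span_base)
    ultimately have "card (insert c B) \<le> card (G ` B)"
      using independent_span_bound[of "G ` B" "insert c B"] finB by auto
    then show False
      using \<open>c \<notin> B\<close> finB card_image_le[OF finB, of G] by simp
  qed
  then have "span (G ` B) \<subseteq> span B" by (simp add: span_minimal)
  then show ?thesis using B(3) by (simp add: linear_span_image[OF assms(1)])
qed

text \<open>Self-adjointness makes the orthogonal complement \<open>N\<close> of the invariant span
  \<open>W\<close> invariant as well, so eigenvectors \<open>B1\<close> of \<open>W\<close> and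
  \<open>B2\<close> of \<open>N\<close> together form an orthonormal basis. By \<open>dom\<close>,
  no eigenvalue on \<open>N\<close> exceeds one on \<open>W\<close>, so \<open>B1\<close> can be
  listed first.\<close>

lemma leading_eigenfunctions_span:
  fixes G :: "'a::{real_inner, banach} \<Rightarrow> 'a"
  assumes comp: "compact_operator G" and sa: "selfadjoint_operator G" and psd: "psd_operator G"
    and F: "finite F" and inv: "G ` span F \<subseteq> span F"
    and dom: "\<And>w e l m. \<lbrakk>w \<in> span F; norm w = 1; G w = m *\<^sub>R w; norm e = 1; G e = l *\<^sub>R e;
      \<And>y. y \<in> span F \<Longrightarrow> e \<bullet> y = 0\<rbrakk> \<Longrightarrow> l \<le> m"
  shows "\<exists>f. leading_eigenfunctions G (dim (span F)) f \<and> span F = span (f ` {..<dim (span F)})"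
proof -
  define W where "W = span F"
  define N where "N = (\<Inter>y\<in>W. {x. y \<bullet> x = 0})"
  have N: "x \<in> N \<longleftrightarrow> (\<forall>y\<in>W. x \<bullet> y = 0)" for x by (auto simp: N_def inner_commute)
  have "subspace W" "closed W" by (simp_all add: W_def closed_span_finite F)
  then obtain B1 where B1: "B1 \<subseteq> W" "\<forall>e\<in>B1. norm e = 1" "pairwise orthogonal B1"
    "\<forall>e\<in>B1. \<exists>l. eigenfunction G l e" "\<And>x. \<lbrakk>x \<in> W; \<And>b. b \<in> B1 \<Longrightarrow> x \<bullet> b = 0\<rbrakk> \<Longrightarrow> x = 0"
    using ex_maximal_orthonormal_eigenfunctions[OF comp sa psd, of W] inv unfolding W_def by metis
  have "subspace N" unfolding N_def
    by (intro subspace_Inter) (auto simp: subspace_hyperplane)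
  moreover have "closed N" unfolding N_def
    by (intro closed_INT) (auto simp: closed_hyperplane)
  moreover have "G ` N \<subseteq> N"
    using sa inv unfolding selfadjoint_operator_def by (auto simp: N W_def image_subset_iff)
  ultimately obtain B2 where B2: "B2 \<subseteq> N" "\<forall>e\<in>B2. norm e = 1" "pairwise orthogonal B2"
    "\<forall>e\<in>B2. \<exists>l. eigenfunction G l e" "\<And>x. \<lbrakk>x \<in> N; \<And>b. b \<in> B2 \<Longrightarrow> x \<bullet> b = 0\<rbrakk> \<Longrightarrow> x = 0"
    using ex_maximal_orthonormal_eigenfunctions[OF comp sa psd, of N] by metis
  have ind: "independent B1"
    using B1(2,3) by (intro pairwise_orthogonal_independent) auto
  have finB1: "finite B1"
    using independent_span_bound[OF F ind] B1(1) by (simp add: W_def)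
  have spB1: "span B1 = W"
  proof
    show "span B1 \<subseteq> W" using B1(1) \<open>subspace W\<close> by (simp add: span_minimal)
    show "W \<subseteq> span B1"
    proof
      fix x assume x: "x \<in> W"
      obtain p r where pr: "x = p + r" "p \<in> span B1" "\<And>y. y \<in> span B1 \<Longrightarrow> r \<bullet> y = 0"
        using finite_span_decomposition[OF finB1] by metis
      have "x - p \<in> W" using x pr(2) \<open>span B1 \<subseteq> W\<close> \<open>subspace W\<close> by (auto intro: subspace_diff)
      then have "r = 0" using B1(5)[of r] pr by (simp add: span_base)
      then show "x \<in> span B1" using pr by simp
    qed
  qed
  then have card: "card B1 = dim W"
    using ind dim_eq_card[of B1 W] span_eq_iff[THEN iffD2, OF \<open>subspace W\<close>] by simp
  obtain l where l: "\<And>e. e \<in> B1 \<union> B2 \<Longrightarrow> eigenfunction G (l e) e"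
    using bchoice[of "B1 \<union> B2" "\<lambda>e l. eigenfunction G l e"] B1(4) B2(4) by blast
  obtain xs where xs: "set xs = B1" "distinct xs" using finB1 finite_distinct_list by blast
  define ys where "ys = sort_key (\<lambda>e. - l e) xs"
  have ys: "set ys = B1" "distinct ys" "sorted (map (\<lambda>e. - l e) ys)"
    using xs by (auto simp: ys_def)
  have len: "length ys = dim W" using card distinct_card[OF ys(2)] ys(1) by simp
  have img: "(!) ys ` {..<dim W} = B1"
    using ys(1) len by (auto simp: set_conv_nth image_def)
  have basis: "orthonormal_basis (B1 \<union> B2)"
    unfolding orthonormal_basis_def
  proof (intro conjI)
    show "\<forall>e\<in>B1 \<union> B2. norm e = 1" using B1(2) B2(2) by auto
    show "pairwise orthogonal (B1 \<union> B2)"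
      unfolding pairwise_def
    proof (intro ballI impI)
      fix x y assume "x \<in> B1 \<union> B2" "y \<in> B1 \<union> B2" "x \<noteq> y"
      moreover have "orthogonal a b" "orthogonal b a" if "a \<in> B1" "b \<in> B2" for a b
        using B1(1) B2(1) that N[of b] by (auto simp: orthogonal_def inner_commute)
      ultimately show "orthogonal x y"
        using B1(3) B2(3) by (auto simp: pairwise_def)
    qed
    \<comment> \<open>A vector orthogonal to the closed span is orthogonal to \<open>W\<close>,
      hence lies in \<open>N\<close>, and orthogonality to \<open>B2\<close> then makes it
      zero.\<close>
    show "closure (span (B1 \<union> B2)) = UNIV"
    proof (rule ccontr)
      assume "closure (span (B1 \<union> B2)) \<noteq> UNIV"
      then obtain z where z: "z \<noteq> 0" "\<forall>y\<in>closure (span (B1 \<union> B2)). z \<bullet> y = 0"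
        using ex_nonzero_orthogonal[of "closure (span (B1 \<union> B2))"]
        by (auto simp: subspace_closure)
      have z0: "z \<bullet> y = 0" if "y \<in> span (B1 \<union> B2)" for y
        using that z closure_subset by blast
      have "z \<in> N"
        unfolding N using z0 span_mono[of B1 "B1 \<union> B2"] spB1 by auto
      then have "z = 0" using B2(5) z0 by (simp add: span_base)
      with z show False by simp
    qed
  qed
  have "leading_eigenfunctions G (dim W) ((!) ys)"
    unfolding leading_eigenfunctions_def
  proof (intro exI conjI)
    show "orthonormal_basis (B1 \<union> B2)" by (rule basis)
    show "\<forall>e\<in>B1 \<union> B2. eigenfunction G (l e) e" using l by simp
    show "inj_on ((!) ys) {..<dim W}" using ys(2) len by (simp add: inj_on_nth)
    show "(!) ys ` {..<dim W} \<subseteq> B1 \<union> B2" using img by simp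
    show "\<forall>i j. i \<le> j \<and> j < dim W \<longrightarrow> l (ys ! j) \<le> l (ys ! i)"
      using ys(3) len by (auto simp: sorted_iff_nth_mono)
    show "\<forall>i<dim W. \<forall>e\<in>B1 \<union> B2 - (!) ys ` {..<dim W}. l e \<le> l (ys ! i)"
    proof (intro allI impI ballI)
      fix i e assume i: "i < dim W" and e: "e \<in> B1 \<union> B2 - (!) ys ` {..<dim W}"
      have w: "ys ! i \<in> B1" using i img by auto
      have e2: "e \<in> B2" using e img by auto
      show "l e \<le> l (ys ! i)"
      proof (rule dom)
        show "ys ! i \<in> span F" "norm (ys ! i) = 1" "norm e = 1"
          using w B1(1,2) B2(2) e2 by (auto simp: W_def)
        show "G (ys ! i) = l (ys ! i) *\<^sub>R ys ! i" "G e = l e *\<^sub>R e"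
          using l w e2 by (auto simp: eigenfunction_def)
        show "e \<bullet> y = 0" if "y \<in> span F" for y
          using e2 B2(1) N[of e] that by (auto simp: W_def)
      qed
    qed
  qed
  then show ?thesis using img spB1 by (auto simp: W_def)
qed

section \<open>Laws of elliptical random elements\<close>

lemma sum_lessThan_add:
  fixes f :: "nat \<Rightarrow> 'a::comm_monoid_add"
  shows "(\<Sum>i<m + n. f i) = (\<Sum>i<m. f i) + (\<Sum>i<n. f (m + i))"
  by (induction n) (simp_all add: add.assoc)

text \<open>Makes \<open>conj_matrix\<close> explicit: for the map with components
  \<open>x \<bullet> c i\<close>, its entries become \<open>G (c j) \<bullet> c i\<close>.\<close>

lemma adjoint_vec_unit_vec:
  fixes c :: "nat \<Rightarrow> 'a::real_inner"
  assumes "j < n"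
  shows "adjoint_vec n (\<lambda>x i. x \<bullet> c i) (unit_vec j) = c j"
proof -
  have *: "(\<Sum>i<n. (x \<bullet> c i) * unit_vec j i) = x \<bullet> c j" for x
  proof -
    have "(\<Sum>i<n. (x \<bullet> c i) * unit_vec j i) = (\<Sum>i<n. if i = j then x \<bullet> c i else 0)"
      by (intro sum.cong) (auto simp: unit_vec_def)
    then show ?thesis using assms by simp
  qed
  show ?thesis
    unfolding adjoint_vec_def *
  proof (rule the_equality)
    fix z assume "\<forall>x. x \<bullet> c j = x \<bullet> z"
    then have "(c j - z) \<bullet> (c j - z) = 0" by (simp add: inner_diff_right)
    then show "z = c j" by simp
  qed simp
qed

text \<open>
  The generator may depend on the operator into \<open>\<real>\<^sup>d\<close>, so two families of functionals are
  compared through their juxtaposition, a map into \<open>\<real>\<^sup>d\<^sup>+\<^sup>d\<close>.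
\<close>

lemma elliptical_mv_char_eq:
  assumes "elliptical_with M V m G"
    and form: "\<And>i j. \<lbrakk>i < d; j < d\<rbrakk> \<Longrightarrow> G (a j) \<bullet> a i = G (b j) \<bullet> b i"
  shows "mv_char M d (\<lambda>w i. (V w - m) \<bullet> a i) t = mv_char M d (\<lambda>w i. (V w - m) \<bullet> b i) t"
proof -
  define c where "c i = (if i < d then a i else b (i - d))" for i
  define S where "S = conj_matrix (d + d) (\<lambda>x i. x \<bullet> c i) G"
  have "bounded_linear_vec (d + d) (\<lambda>x i. x \<bullet> c i)"
    unfolding bounded_linear_vec_def by (simp add: bounded_linear_inner_left)
  then have "elliptical_vec M (d + d) (\<lambda>w i. V w \<bullet> c i) (\<lambda>i. m \<bullet> c i) S"
    using assms(1) unfolding elliptical_with_def S_def by blast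
  then obtain \<phi> :: "real \<Rightarrow> real" where \<phi>: "\<And>t. mv_char M (d + d) (\<lambda>w i. V w \<bullet> c i - m \<bullet> c i) t
      = complex_of_real (\<phi> (\<Sum>i<d + d. \<Sum>j<d + d. t i * S i j * t j))"
    unfolding elliptical_vec_def by blast
  have S: "S i j = G (c j) \<bullet> c i" if "j < d + d" for i j
    using that by (simp add: S_def conj_matrix_def adjoint_vec_unit_vec)
  \<comment> \<open>The vector \<open>t\<close> placed in the first and in the second block. By
    \<open>form\<close> the quadratic form has the same value at both, so the single generator
    \<open>\<phi>\<close> gives equal transforms.\<close>
  define t1 t2 where "t1 = (\<lambda>i. if i < d then t i else 0)" and "t2 = (\<lambda>i. if i < d then 0 else t (i - d))"
  have 1: "(\<Sum>i<d + d. t1 i * f i) = (\<Sum>i<d. t i * f i)"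
    and 2: "(\<Sum>i<d + d. t2 i * f i) = (\<Sum>i<d. t i * f (d + i))" for f :: "nat \<Rightarrow> real"
    by (simp_all add: sum_lessThan_add t1_def t2_def)
  have q: "(\<Sum>i<d + d. \<Sum>j<d + d. s i * S i j * s j) = (\<Sum>i<d + d. s i * (\<Sum>j<d + d. s j * S i j))" for s
    by (simp add: sum_distrib_left mult_ac)
  have "(\<Sum>i<d + d. \<Sum>j<d + d. t1 i * S i j * t1 j) = (\<Sum>i<d + d. \<Sum>j<d + d. t2 i * S i j * t2 j)"
    unfolding q 1 2 using form by (intro sum.cong refl) (simp add: S c_def)
  then have "mv_char M (d + d) (\<lambda>w i. V w \<bullet> c i - m \<bullet> c i) t1
      = mv_char M (d + d) (\<lambda>w i. V w \<bullet> c i - m \<bullet> c i) t2"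
    by (simp add: \<phi>)
  then show ?thesis
    unfolding mv_char_def 1 2 by (simp add: c_def inner_diff_left)
qed

section \<open>Second moments and laws of a centred elliptical element\<close>

locale centred_elliptical = prob_space M for M :: "'w measure" +
  fixes V :: "'w \<Rightarrow> 'a::{real_inner, banach, second_countable_topology}"
  assumes elliptical: "elliptical M V"
    and square_integrable: "integrable M (\<lambda>w. (norm (V w))\<^sup>2)"
    and mean_zero: "(\<integral>w. V w \<partial>M) = 0"
begin

lemma measurable_V [measurable]: "V \<in> borel_measurable M"
  using elliptical by (auto simp: elliptical_def elliptical_with_def)

lemma integrable_V: "integrable M V"
proof (rule Bochner_Integration.integrable_bound)
  show "integrable M (\<lambda>w. 1 + (norm (V w))\<^sup>2)" using square_integrable by simp
  have "x \<le> 1 + x\<^sup>2" if "0 \<le> x" for x :: real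
    using that sum_squares_bound[of x 1] by simp
  then show "AE w in M. norm (V w) \<le> norm (1 + (norm (V w))\<^sup>2)"
    by simp
qed simp

lemma integrable_inner_V: "integrable M (\<lambda>w. V w \<bullet> u)"
  using integrable_V by simp

lemma integral_inner_V: "(\<integral>w. V w \<bullet> u \<partial>M) = 0"
  using integral_inner_left[of u M V] integrable_V by (simp add: mean_zero)

lemma integrable_inner_V_mult: "integrable M (\<lambda>w. (V w \<bullet> u) * (V w \<bullet> v))"
proof (rule Bochner_Integration.integrable_bound)
  show "integrable M (\<lambda>w. norm u * norm v * (norm (V w))\<^sup>2)" using square_integrable by simp
  have "\<bar>x \<bullet> u\<bar> * \<bar>x \<bullet> v\<bar> \<le> (norm x * norm u) * (norm x * norm v)" for x
    by (intro mult_mono Cauchy_Schwarz_ineq2) auto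
  from this[of "V _"] show "AE w in M. norm ((V w \<bullet> u) * (V w \<bullet> v)) \<le> norm (norm u * norm v * (norm (V w))\<^sup>2)"
    by (intro AE_I2) (simp add: abs_mult power2_eq_square mult_ac)
qed simp

lemma covariance_operator_eq:
  "covariance_operator M V u \<bullet> v = (\<integral>w. (V w \<bullet> u) * (V w \<bullet> v) \<partial>M)"
  unfolding covariance_operator_inner[OF prob_space_axioms measurable_V square_integrable]
  by (simp add: covariance_def inner_commute[of _ "V _"] integral_inner_V)

lemma selfadjoint_covariance: "selfadjoint_operator (covariance_operator M V)"
  unfolding selfadjoint_operator_def
  by (simp add: covariance_operator_eq inner_commute[of _ "covariance_operator M V _"] mult.commute)

lemma psd_covariance: "psd_operator (covariance_operator M V)"
  unfolding psd_operator_def by (simp add: covariance_operator_eq)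

lemma law_eq_if_form_eq:
  fixes a b :: "nat \<Rightarrow> 'a" and f :: "(nat \<Rightarrow> real) \<Rightarrow> real"
  assumes G: "elliptical_with M V m G"
    and form: "\<And>i j. \<lbrakk>i < d; j < d\<rbrakk> \<Longrightarrow> G (a j) \<bullet> a i = G (b j) \<bullet> b i"
    and f: "f \<in> borel_measurable (Pi\<^sub>M {..<d} (\<lambda>_. borel))"
  shows "(\<integral>w. f (\<lambda>i\<in>{..<d}. (V w - m) \<bullet> a i) \<partial>M) = (\<integral>w. f (\<lambda>i\<in>{..<d}. (V w - m) \<bullet> b i) \<partial>M)"
proof -
  have *: "(\<lambda>w. \<lambda>i\<in>{..<d}. (V w - m) \<bullet> c i) \<in> measurable M (Pi\<^sub>M {..<d} (\<lambda>_. borel))" for c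
    by (intro measurable_restrict) simp
  have "distr M (Pi\<^sub>M {..<d} (\<lambda>_. borel)) (\<lambda>w. \<lambda>i\<in>{..<d}. (V w - m) \<bullet> a i)
      = distr M (Pi\<^sub>M {..<d} (\<lambda>_. borel)) (\<lambda>w. \<lambda>i\<in>{..<d}. (V w - m) \<bullet> b i)"
    by (rule distr_eqI_char[where X="\<lambda>w i. (V w - m) \<bullet> a i" and Y="\<lambda>w i. (V w - m) \<bullet> b i"])
      (auto intro!: prob_space_axioms elliptical_mv_char_eq[OF G form])
  then show ?thesis
    using integral_distr[OF * f, of a] integral_distr[OF * f, of b] by simp
qed

text \<open>The form of \<open>G\<close> is even, so \<open>(V w - m) \<bullet> m\<close> has a
  symmetric law and mean zero. Since \<open>V\<close> is centred, this mean is also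
  \<open>- (m \<bullet> m)\<close>.\<close>

lemma location_zero:
  assumes G: "elliptical_with M V m G"
  shows "m = 0"
proof -
  have lin: "linear G"
    using G by (auto simp: elliptical_with_def compact_operator_def bounded_linear.linear)
  have "(\<integral>w. (\<lambda>z. z 0) (\<lambda>i\<in>{..<1::nat}. (V w - m) \<bullet> m) \<partial>M)
      = (\<integral>w. (\<lambda>z. z 0) (\<lambda>i\<in>{..<1::nat}. (V w - m) \<bullet> (- m)) \<partial>M :: real)"
    by (rule law_eq_if_form_eq[OF G]) (auto simp: linear_neg[OF lin])
  then have "(\<integral>w. (V w - m) \<bullet> m \<partial>M) = - (\<integral>w. (V w - m) \<bullet> m \<partial>M)"
    by simp
  moreover have "(\<integral>w. (V w - m) \<bullet> m \<partial>M) = - (m \<bullet> m)"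
    using integrable_inner_V by (simp add: inner_diff_left integral_inner_V prob_space)
  ultimately show ?thesis by simp
qed

text \<open>
  Rescaling a functional so that its scale parameter matches that of another one makes their
  laws equal, so the second moments are proportional to the scale parameters.
\<close>

lemma covariance_proportional:
  assumes G: "elliptical_with M V m G"
  shows "\<exists>c. \<forall>u v. covariance_operator M V u \<bullet> v = c * (G u \<bullet> v)"
proof -
  have lin: "linear G"
    using G by (auto simp: elliptical_with_def compact_operator_def bounded_linear.linear)
  have sa: "G u \<bullet> v = G v \<bullet> u" for u v
    using G by (auto simp: elliptical_with_def selfadjoint_operator_def inner_commute)
  have psd: "0 \<le> G u \<bullet> u" for u
    using G by (auto simp: elliptical_with_def psd_operator_def)
  have var_eq: "(\<integral>w. (V w \<bullet> u)\<^sup>2 \<partial>M) = (\<integral>w. (V w \<bullet> v)\<^sup>2 \<partial>M)" if "G u \<bullet> u = G v \<bullet> v" for u v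
  proof -
    have "(\<integral>w. (\<lambda>z. (z 0)\<^sup>2) (\<lambda>i\<in>{..<1::nat}. (V w - m) \<bullet> u) \<partial>M)
      = (\<integral>w. (\<lambda>z. (z 0)\<^sup>2) (\<lambda>i\<in>{..<1::nat}. (V w - m) \<bullet> v) \<partial>M :: real)"
      using that by (intro law_eq_if_form_eq[OF G]) auto
    then show ?thesis using location_zero[OF G] by simp
  qed
  have "\<exists>c. \<forall>u. (\<integral>w. (V w \<bullet> u)\<^sup>2 \<partial>M) = c * (G u \<bullet> u)"
  proof (cases "\<exists>u. G u \<bullet> u \<noteq> 0")
    case True
    then obtain v where "G v \<bullet> v \<noteq> 0" by blast
    then have v: "0 < G v \<bullet> v" using psd[of v] by simp
    have "(\<integral>w. (V w \<bullet> u)\<^sup>2 \<partial>M) = (\<integral>w. (V w \<bullet> v)\<^sup>2 \<partial>M) / (G v \<bullet> v) * (G u \<bullet> u)" for u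
    proof -
      define s where "s = sqrt ((G u \<bullet> u) / (G v \<bullet> v))"
      have s2: "s\<^sup>2 = (G u \<bullet> u) / (G v \<bullet> v)" using psd[of u] v by (simp add: s_def)
      have "G u \<bullet> u = G (s *\<^sub>R v) \<bullet> (s *\<^sub>R v)"
        using s2 v by (simp add: linear_scale[OF lin] power2_eq_square flip: mult.assoc)
      then have "(\<integral>w. (V w \<bullet> u)\<^sup>2 \<partial>M) = (\<integral>w. (V w \<bullet> (s *\<^sub>R v))\<^sup>2 \<partial>M)" by (rule var_eq)
      also have "\<dots> = s\<^sup>2 * (\<integral>w. (V w \<bullet> v)\<^sup>2 \<partial>M)" by (simp add: power_mult_distrib)
      finally show ?thesis by (simp add: s2)
    qed
    then show ?thesis by blast
  \<comment> \<open>If the form vanishes identically, every \<open>u\<close> has the scale parameter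
    of the zero vector, so all second moments are zero and any \<open>c\<close> works.\<close>
  next
    case False
    then have "(\<integral>w. (V w \<bullet> u)\<^sup>2 \<partial>M) = (\<integral>w. (V w \<bullet> 0)\<^sup>2 \<partial>M)" for u
      by (intro var_eq) simp
    then show ?thesis by auto
  qed
  then obtain c where c: "\<And>u. (\<integral>w. (V w \<bullet> u)\<^sup>2 \<partial>M) = c * (G u \<bullet> u)" by blast
  \<comment> \<open>Polarisation carries the proportionality from squares to mixed moments.\<close>
  have "covariance_operator M V u \<bullet> v = c * (G u \<bullet> v)" for u v
  proof -
    have "(\<integral>w. (V w \<bullet> (u + v))\<^sup>2 \<partial>M) = (\<integral>w. (V w \<bullet> u)\<^sup>2 \<partial>M) + (\<integral>w. (V w \<bullet> v)\<^sup>2 \<partial>M)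
        + 2 * (\<integral>w. (V w \<bullet> u) * (V w \<bullet> v) \<partial>M)"
    proof -
      have "(V w \<bullet> (u + v))\<^sup>2 = (V w \<bullet> u) * (V w \<bullet> u) + (V w \<bullet> v) * (V w \<bullet> v)
        + 2 * ((V w \<bullet> u) * (V w \<bullet> v))" for w
        by (simp add: inner_add_right power2_eq_square algebra_simps)
      then show ?thesis
        using integrable_inner_V_mult by (simp add: power2_eq_square)
    qed
    moreover have "G (u + v) \<bullet> (u + v) = G u \<bullet> u + G v \<bullet> v + 2 * (G u \<bullet> v)"
      using sa[of u v] by (simp add: linear_add[OF lin] inner_add)
    ultimately show ?thesis
      using c[of "u + v"] c[of u] c[of v] by (simp add: covariance_operator_eq algebra_simps)
  qed
  then show ?thesis by blast
qed

text \<open>Replaces the scale operator \<open>G\<close> by the covariance operator in the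
  comparison of laws. Passing from one form to the other divides by their ratio \<open>c\<close>,
  and \<open>nz\<close> ensures \<open>c \<noteq> 0\<close>.\<close>

lemma law_eq_if_covariance_eq:
  fixes a b :: "nat \<Rightarrow> 'a" and f :: "(nat \<Rightarrow> real) \<Rightarrow> real"
  assumes nz: "covariance_operator M V u \<noteq> 0"
    and form: "\<And>i j. \<lbrakk>i < d; j < d\<rbrakk> \<Longrightarrow>
      covariance_operator M V (a i) \<bullet> a j = covariance_operator M V (b i) \<bullet> b j"
    and f: "f \<in> borel_measurable (Pi\<^sub>M {..<d} (\<lambda>_. borel))"
  shows "(\<integral>w. f (\<lambda>i\<in>{..<d}. V w \<bullet> a i) \<partial>M) = (\<integral>w. f (\<lambda>i\<in>{..<d}. V w \<bullet> b i) \<partial>M)"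
proof -
  obtain m G where G: "elliptical_with M V m G"
    using elliptical by (auto simp: elliptical_def)
  obtain c where c: "\<And>u v. covariance_operator M V u \<bullet> v = c * (G u \<bullet> v)"
    using covariance_proportional[OF G] by blast
  have "c \<noteq> 0"
    using c[of u "covariance_operator M V u"] nz by auto
  then have "G (a j) \<bullet> a i = G (b j) \<bullet> b i" if "i < d" "j < d" for i j
    using form[OF that(2,1)] c by simp
  from law_eq_if_form_eq[OF G this f] show ?thesis
    using location_zero[OF G] by simp
qed

end

section \<open>Principal points\<close>

text \<open>Taking the least minimiser breaks ties, so that the cells of the points are disjoint and
  measurable.\<close>

definition argmin_below :: "nat \<Rightarrow> (nat \<Rightarrow> real) \<Rightarrow> nat" where
  "argmin_below k h = (LEAST j. j < k \<and> (\<forall>i<k. h j \<le> h i))"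

lemma argmin_below:
  assumes "1 \<le> k"
  shows argmin_below_less: "argmin_below k h < k"
    and argmin_below_le: "i < k \<Longrightarrow> h (argmin_below k h) \<le> h i"
    and Min_eq_argmin_below: "Min (h ` {..<k}) = h (argmin_below k h)"
proof -
  have "Min (h ` {..<k}) \<in> h ` {..<k}" using assms by (intro Min_in) (auto simp: lessThan_empty_iff)
  then obtain j where "j < k" "h j = Min (h ` {..<k})" by auto
  then have "\<exists>j. j < k \<and> (\<forall>i<k. h j \<le> h i)" by (intro exI[of _ j]) auto
  from LeastI_ex[OF this] have *: "argmin_below k h < k" "\<And>i. i < k \<Longrightarrow> h (argmin_below k h) \<le> h i"
    unfolding argmin_below_def by auto
  show "argmin_below k h < k" by (rule *)
  show "i < k \<Longrightarrow> h (argmin_below k h) \<le> h i" by (rule *)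
  show "Min (h ` {..<k}) = h (argmin_below k h)" using * by (intro Min_eqI) auto
qed

lemma argmin_below_cong:
  "(\<And>i. i < k \<Longrightarrow> h i = h' i) \<Longrightarrow> argmin_below k h = argmin_below k h'"
  unfolding argmin_below_def by (rule arg_cong[where f=Least]) auto

lemma measurable_argmin_below:
  assumes "\<And>i. i < k \<Longrightarrow> (\<lambda>x. h x i) \<in> borel_measurable N"
  shows "(\<lambda>x. argmin_below k (h x)) \<in> measurable N (count_space UNIV)"
  unfolding argmin_below_def
proof (rule measurable_Least)
  fix j
  have [measurable]: "(\<lambda>x. h x i) \<in> borel_measurable N" if "i \<in> {..<k}" for i using assms that by simp
  show "Measurable.pred N (\<lambda>x. j < k \<and> (\<forall>i<k. h x j \<le> h x i))"
  proof (cases "j < k")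
    case True
    then have [measurable]: "(\<lambda>x. h x j) \<in> borel_measurable N" using assms by simp
    have "Measurable.pred N (\<lambda>x. \<forall>i\<in>{..<k}. h x j \<le> h x i)" by measurable
    then show ?thesis using True by (simp add: lessThan_def Ball_def)
  qed simp
qed

text \<open>The term \<open>(norm x)\<^sup>2\<close> is common to all squared distances, so
  minimising the distance means minimising affine functions of \<open>x\<close>; only the inner
  products with the points matter.\<close>

lemma dist_points_power2:
  fixes x :: "'a::real_inner"
  assumes "1 \<le> k"
  shows "(dist_points x k y)\<^sup>2 = (norm x)\<^sup>2 + Min ((\<lambda>j. (norm (y j))\<^sup>2 - 2 * (x \<bullet> y j)) ` {..<k})"
proof -
  let ?h = "\<lambda>j. (norm (y j))\<^sup>2 - 2 * (x \<bullet> y j)"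
  let ?J = "argmin_below k ?h"
  have sq: "(norm (x - y j))\<^sup>2 = (norm x)\<^sup>2 + ?h j" for j
    unfolding power2_norm_eq_inner by (simp add: inner_diff inner_commute)
  have "dist_points x k y = norm (x - y ?J)"
    unfolding dist_points_def
  proof (rule Min_eqI)
    show "norm (x - y ?J) \<in> (\<lambda>j. norm (x - y j)) ` {..<k}"
      using argmin_below_less[OF assms] by blast
    fix z assume "z \<in> (\<lambda>j. norm (x - y j)) ` {..<k}"
    then obtain i where i: "i < k" "z = norm (x - y i)" by auto
    have "(norm (x - y ?J))\<^sup>2 \<le> (norm (x - y i))\<^sup>2"
      unfolding sq using argmin_below_le[OF assms i(1), of ?h] by simp
    then show "norm (x - y ?J) \<le> z" unfolding i(2) by (rule power2_le_imp_le) simp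
  qed simp
  then show ?thesis using sq Min_eq_argmin_below[OF assms, of ?h] by simp
qed

text \<open>A first-order condition without derivatives, applied below to perturbations of a single
  point. Any positive \<open>d\<close> above \<open>c\<close> serves: at \<open>s = - b / d\<close>
  the polynomial is at most \<open>- (b\<^sup>2 / d)\<close>.\<close>

lemma linear_coefficient_zero:
  fixes b c :: real
  assumes "\<And>s. 0 \<le> 2 * s * b + s\<^sup>2 * c"
  shows "b = 0"
proof (rule ccontr)
  assume "b \<noteq> 0"
  define d where "d = \<bar>c\<bar> + 1"
  have d: "d > 0" "c < d" by (auto simp: d_def)
  have "0 \<le> 2 * (- b / d) * b + (- b / d)\<^sup>2 * c" by (rule assms)
  also have "\<dots> \<le> 2 * (- b / d) * b + (- b / d)\<^sup>2 * d"
    using d by (intro add_left_mono mult_left_mono) auto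
  also have "\<dots> = - (b\<^sup>2 / d)" using d by (simp add: power2_eq_square field_simps)
  finally show False using d \<open>b \<noteq> 0\<close> by (simp add: divide_le_0_iff)
qed

section \<open>Optimality conditions for principal points\<close>

locale principal_elliptical = centred_elliptical M V
  for M :: "'w measure" and V :: "'w \<Rightarrow> 'a::{real_inner, banach, second_countable_topology}" +
  fixes k :: nat and \<xi> :: "nat \<Rightarrow> 'a"
  assumes principal: "principal_points M V k \<xi>"
begin

lemma k_pos: "1 \<le> k"
  using principal by (simp add: principal_points_def)

text \<open>The squared distance from \<open>V w\<close> to \<open>y j\<close>, less the common term
  \<open>(norm (V w))\<^sup>2\<close>.\<close>

definition score :: "(nat \<Rightarrow> 'a) \<Rightarrow> 'w \<Rightarrow> nat \<Rightarrow> real" where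
  "score y w j = (norm (y j))\<^sup>2 - 2 * (V w \<bullet> y j)"

definition obj :: "(nat \<Rightarrow> 'a) \<Rightarrow> 'w \<Rightarrow> real" where
  "obj y w = Min (score y w ` {..<k})"

text \<open>The level sets of \<open>J\<close> are the Voronoi cells of the principal
  points.\<close>

definition J :: "'w \<Rightarrow> nat" where
  "J w = argmin_below k (score \<xi> w)"

lemma measurable_score [measurable]: "(\<lambda>w. score y w j) \<in> borel_measurable M"
  unfolding score_def by measurable

lemma measurable_J [measurable]: "J \<in> measurable M (count_space UNIV)"
  unfolding J_def[abs_def] by (rule measurable_argmin_below) simp

lemma J_less: "J w < k"
  unfolding J_def by (rule argmin_below_less[OF k_pos])

lemma obj_eq: "obj \<xi> w = score \<xi> w (J w)"
  unfolding obj_def J_def by (rule Min_eq_argmin_below[OF k_pos])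

lemma obj_le: "j < k \<Longrightarrow> obj y w \<le> score y w j"
  unfolding obj_def by (rule Min_le) auto

lemma integrable_score: "integrable M (\<lambda>w. score y w j)"
  unfolding score_def using integrable_inner_V by simp

lemma integrable_Min:
  assumes "\<And>j. j < k \<Longrightarrow> integrable M (\<lambda>w. h w j)"
  shows "integrable M (\<lambda>w. Min (h w ` {..<k}) :: real)"
proof (rule Bochner_Integration.integrable_bound)
  show "integrable M (\<lambda>w. \<Sum>j<k. \<bar>h w j\<bar>)"
    by (intro Bochner_Integration.integrable_sum integrable_abs assms) simp
  have "Min (h w ` {..<k}) \<in> h w ` {..<k}" for w
    using k_pos by (intro Min_in) (auto simp: lessThan_empty_iff)
  then have "\<bar>Min (h w ` {..<k})\<bar> \<le> (\<Sum>j<k. \<bar>h w j\<bar>)" for w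
    using member_le_sum[of _ "{..<k}" "\<lambda>j. \<bar>h w j\<bar>"] by (smt (verit) imageE abs_ge_zero finite_lessThan DiffD1)
  then show "AE w in M. norm (Min (h w ` {..<k})) \<le> norm (\<Sum>j<k. \<bar>h w j\<bar>)"
    by (simp add: order_trans[OF _ abs_ge_self])
  show "(\<lambda>w. Min (h w ` {..<k})) \<in> borel_measurable M"
    using borel_measurable_Min[of "{..<k}" "\<lambda>j w. h w j" M] assms by simp
qed

lemma integrable_obj: "integrable M (obj y)"
  unfolding obj_def[abs_def] by (rule integrable_Min) (rule integrable_score)

lemma obj_optimal: "(\<integral>w. obj \<xi> w \<partial>M) \<le> (\<integral>w. obj y w \<partial>M)"
proof -
  have "(dist_points (V w) k y)\<^sup>2 = (norm (V w))\<^sup>2 + obj y w" for y w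
    unfolding dist_points_power2[OF k_pos] obj_def score_def[abs_def] ..
  then have "(\<integral>w. (dist_points (V w) k y)\<^sup>2 \<partial>M) = (\<integral>w. (norm (V w))\<^sup>2 \<partial>M) + (\<integral>w. obj y w \<partial>M)" for y
    using integrable_obj square_integrable by simp
  moreover have "(\<integral>w. (dist_points (V w) k \<xi>)\<^sup>2 \<partial>M) \<le> (\<integral>w. (dist_points (V w) k y)\<^sup>2 \<partial>M)"
    using principal by (simp add: principal_points_def)
  ultimately show ?thesis by simp
qed

lemma J_sum: "f (J w) = (\<Sum>j<k. indicator {j} (J w) * f j)" for f :: "nat \<Rightarrow> real"
proof -
  have "(\<Sum>j<k. indicator {j} (J w) * f j) = (\<Sum>j<k. if j = J w then f j else 0)"
    by (intro sum.cong) auto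
  then show ?thesis using J_less by simp
qed

lemma integrable_J_mult:
  assumes "integrable M f"
  shows "integrable M (\<lambda>w. indicator {j} (J w) * f w :: real)"
proof (rule Bochner_Integration.integrable_bound[OF assms])
  show "(\<lambda>w. indicator {j} (J w) * f w) \<in> borel_measurable M"
    using measurable_compose[OF measurable_J, of "indicator {j}" borel] assms
    by (intro borel_measurable_times) auto
qed (auto simp: indicator_def)

lemma integrable_J: "integrable M (\<lambda>w. indicator {j} (J w) :: real)"
  using integrable_J_mult[of "\<lambda>_. 1"] by simp

lemma integral_J_sum:
  assumes "\<And>j. integrable M (f j)"
  shows "integrable M (\<lambda>w. f (J w) w :: real)"
    and "(\<integral>w. f (J w) w \<partial>M) = (\<Sum>j<k. \<integral>w. indicator {j} (J w) * f j w \<partial>M)"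
proof -
  have *: "f (J w) w = (\<Sum>j<k. indicator {j} (J w) * f j w)" for w
    by (rule J_sum)
  show "integrable M (\<lambda>w. f (J w) w)"
    unfolding * using assms by (intro Bochner_Integration.integrable_sum integrable_J_mult)
  show "(\<integral>w. f (J w) w \<partial>M) = (\<Sum>j<k. \<integral>w. indicator {j} (J w) * f j w \<partial>M)"
    unfolding * using assms by (intro Bochner_Integration.integral_sum integrable_J_mult)
qed

text \<open>Each principal point is the mean of \<open>V\<close> over its cell, written without
  dividing by the mass so that null cells are covered. Shifting the point along \<open>v\<close>
  while keeping the old assignment \<open>J\<close> bounds the new objective by a quadratic
  polynomial in the shift, and optimality makes the increment nonnegative.\<close>

lemma self_consistent:
  assumes "j < k"
  shows "(\<integral>w. indicator {j} (J w) * (V w \<bullet> v) \<partial>M) = (\<integral>w. indicator {j} (J w) \<partial>M) * (\<xi> j \<bullet> v)"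
proof -
  define p where "p = (\<integral>w. indicator {j} (J w) \<partial>M :: real)"
  define m where "m = (\<integral>w. indicator {j} (J w) * (V w \<bullet> v) \<partial>M)"
  have "0 \<le> 2 * s * (p * (\<xi> j \<bullet> v) - m) + s\<^sup>2 * (p * (norm v)\<^sup>2)" for s
  proof -
    define y where "y = \<xi>(j := \<xi> j + s *\<^sub>R v)"
    \<comment> \<open>The change in the squared norm of point \<open>j\<close>.\<close>
    define t where "t = 2 * s * (\<xi> j \<bullet> v) + s\<^sup>2 * (norm v)\<^sup>2"
    have le: "obj y w \<le> obj \<xi> w + (t * indicator {j} (J w) - 2 * s * (indicator {j} (J w) * (V w \<bullet> v)))" for w
    proof -
      have "obj y w \<le> score y w (J w)" by (rule obj_le[OF J_less])
      also have "\<dots> = obj \<xi> w + (t * indicator {j} (J w) - 2 * s * (indicator {j} (J w) * (V w \<bullet> v)))"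
        unfolding obj_eq score_def y_def t_def power2_norm_eq_inner
        by (simp add: inner_add inner_commute power2_eq_square algebra_simps)
      finally show ?thesis .
    qed
    have i: "integrable M (\<lambda>w. t * indicator {j} (J w) - 2 * s * (indicator {j} (J w) * (V w \<bullet> v)))"
      using integrable_J integrable_J_mult[OF integrable_inner_V] by simp
    have "(\<integral>w. obj \<xi> w \<partial>M) \<le> (\<integral>w. obj y w \<partial>M)" by (rule obj_optimal)
    also have "\<dots> \<le> (\<integral>w. obj \<xi> w + (t * indicator {j} (J w) - 2 * s * (indicator {j} (J w) * (V w \<bullet> v))) \<partial>M)"
      using integrable_obj i by (intro integral_mono le) auto
    also have "\<dots> = (\<integral>w. obj \<xi> w \<partial>M) + (t * p - 2 * s * m)"
      using integrable_obj i integrable_J integrable_J_mult[OF integrable_inner_V]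
      by (simp add: p_def m_def)
    finally show ?thesis by (simp add: t_def algebra_simps)
  qed
  then have "p * (\<xi> j \<bullet> v) - m = 0" by (rule linear_coefficient_zero)
  then show ?thesis by (simp add: p_def m_def)
qed

text \<open>
  A point with a null cell may be moved anywhere without changing the objective; optimality
  against all such moves forces \<open>V\<close> to sit on the remaining points.
\<close>

lemma concentrated_if_null_cell:
  assumes j: "j < k" and null: "(\<integral>w. indicator {j} (J w) \<partial>M :: real) = 0"
  shows "AE w in M. V w = \<xi> (J w)"
proof -
  have Jj: "AE w in M. J w \<noteq> j"
  proof -
    have "AE w in M. indicator {j} (J w) = (0 :: real)"
      using integral_nonneg_eq_0_iff_AE[OF integrable_J[of j]] null by simp
    then show ?thesis by eventually_elim (auto simp: indicator_def)
  qed
  have le: "AE w in M. norm (V w - \<xi> (J w)) \<le> norm (V w - y)" for y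
  proof -
    have le1: "AE w in M. obj (\<xi>(j := y)) w \<le> obj \<xi> w"
      using Jj
    proof eventually_elim
      case (elim w)
      then show ?case
        using obj_le[OF J_less, of "\<xi>(j := y)" w w] by (simp add: obj_eq score_def)
    qed
    \<comment> \<open>The moved points do no worse almost surely and no better on average, so the
      objectives agree almost surely; hence \<open>y\<close> is almost surely no nearer than the
      assigned point.\<close>
    have "(\<integral>w. obj (\<xi>(j := y)) w \<partial>M) = (\<integral>w. obj \<xi> w \<partial>M)"
      using integral_mono_AE[OF integrable_obj integrable_obj le1] obj_optimal by (intro antisym)
    from integral_ineq_eq_0_then_AE[OF le1 integrable_obj integrable_obj this]
    show ?thesis
    proof eventually_elim
      case (elim w)
      then have "score \<xi> w (J w) \<le> (norm y)\<^sup>2 - 2 * (V w \<bullet> y)"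
        using obj_le[OF j, of "\<xi>(j := y)" w] by (simp add: obj_eq score_def)
      then have "(norm (V w - \<xi> (J w)))\<^sup>2 \<le> (norm (V w - y))\<^sup>2"
        unfolding score_def power2_norm_eq_inner by (simp add: inner_diff inner_commute)
      then show ?case by (rule power2_le_imp_le) simp
    qed
  qed
  \<comment> \<open>A countable dense set allows one exceptional null set for all \<open>y\<close>
    in \<open>D\<close>; if \<open>V w\<close> missed its point, some member of \<open>D\<close>
    would be strictly nearer.\<close>
  obtain D :: "'a set" where D: "countable D" "\<And>X. open X \<Longrightarrow> X \<noteq> {} \<Longrightarrow> \<exists>d\<in>D. d \<in> X"
    using countable_dense_exists by blast
  have "AE w in M. \<forall>y\<in>D. norm (V w - \<xi> (J w)) \<le> norm (V w - y)"
    using D(1) le by (simp add: AE_ball_countable)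
  then show ?thesis
  proof eventually_elim
    case (elim w)
    show ?case
    proof (rule ccontr)
      assume "V w \<noteq> \<xi> (J w)"
      then have "ball (V w) (norm (V w - \<xi> (J w))) \<noteq> {}" by simp
      then obtain d where "d \<in> D" "d \<in> ball (V w) (norm (V w - \<xi> (J w)))"
        using D(2) by blast
      then show False using elim by (force simp: dist_norm)
    qed
  qed
qed

section \<open>The span of the principal points\<close>

abbreviation C :: "'a \<Rightarrow> 'a" where "C \<equiv> covariance_operator M V"

abbreviation W :: "'a set" where "W \<equiv> span (\<xi> ` {..<k})"

lemma covariance_form_zero:
  assumes "AE w in M. V w \<bullet> u = 0"
  shows "C u \<bullet> v = 0"
proof -
  have "AE w in M. (V w \<bullet> u) * (V w \<bullet> v) = 0" using assms by eventually_elim simp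
  then show ?thesis unfolding covariance_operator_eq by (rule integral_eq_zero_AE)
qed

text \<open>Since \<open>u\<close> is uncorrelated with all points under the form of
  \<open>C\<close>, appending \<open>u\<close> or \<open>- u\<close> to them gives the same law. The
  integral of \<open>V w \<bullet> u\<close> over cell \<open>j\<close> therefore equals its
  negative, and \<open>self_consistent\<close> turns its vanishing into orthogonality.\<close>

lemma orthogonal_point_if_orthogonal_image:
  assumes nz: "C x \<noteq> 0" and u: "\<And>w. w \<in> W \<Longrightarrow> u \<bullet> C w = 0"
    and j: "j < k" and p: "(\<integral>w. indicator {j} (J w) \<partial>M :: real) \<noteq> 0"
  shows "\<xi> j \<bullet> u = 0"
proof -
  \<comment> \<open>Coordinate \<open>k\<close> carries the extra vector \<open>v\<close>;
    \<open>f\<close> recomputes the cell from the coordinates below \<open>k\<close> and then reads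
    off coordinate \<open>k\<close>.\<close>
  define a where "a = (\<lambda>v i. if i < k then \<xi> i else v)"
  define f where "f = (\<lambda>z. indicator {j} (argmin_below k (\<lambda>i. (norm (\<xi> i))\<^sup>2 - 2 * z i)) * z k :: real)"
  have comp: "(\<lambda>z. z i) \<in> borel_measurable (Pi\<^sub>M {..<Suc k} (\<lambda>_. borel))" if "i < Suc k" for i
    using that by (intro measurable_component_singleton) simp
  have "(\<lambda>z. argmin_below k (\<lambda>i. (norm (\<xi> i))\<^sup>2 - 2 * z i))
      \<in> measurable (Pi\<^sub>M {..<Suc k} (\<lambda>_. borel)) (count_space UNIV)"
    by (intro measurable_argmin_below borel_measurable_diff borel_measurable_times comp) auto
  from measurable_compose[OF this, of "indicator {j}" borel]
  have f: "f \<in> borel_measurable (Pi\<^sub>M {..<Suc k} (\<lambda>_. borel))"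
    unfolding f_def by (intro borel_measurable_times comp) simp_all
  have f_eq: "f (\<lambda>i\<in>{..<Suc k}. V w \<bullet> a v i) = indicator {j} (J w) * (V w \<bullet> v)" for v w
  proof -
    have "argmin_below k (\<lambda>i. (norm (\<xi> i))\<^sup>2 - 2 * (\<lambda>i\<in>{..<Suc k}. V w \<bullet> a v i) i) = J w"
      unfolding J_def by (rule argmin_below_cong) (simp add: score_def a_def)
    then show ?thesis by (simp add: f_def a_def)
  qed
  have sa: "C x \<bullet> y = x \<bullet> C y" for x y
    using selfadjoint_covariance by (simp add: selfadjoint_operator_def)
  have "C u \<bullet> \<xi> i = 0" "C (- u) \<bullet> \<xi> i = 0" "C (\<xi> i) \<bullet> u = 0" if "i < k" for i
  proof -
    have *: "u \<bullet> C (\<xi> i) = 0" using that by (intro u span_base) auto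
    then show "C u \<bullet> \<xi> i = 0" "C (- u) \<bullet> \<xi> i = 0" by (simp_all only: sa inner_minus_left neg_equal_0_iff_equal)
    show "C (\<xi> i) \<bullet> u = 0" using * by (simp only: inner_commute)
  qed
  moreover have "C (- u) \<bullet> u = - (C u \<bullet> u)" by (simp add: covariance_operator_eq)
  ultimately have "C (a u i) \<bullet> a u l = C (a (- u) i) \<bullet> a (- u) l" for i l
    using k_pos by (auto simp: a_def)
  from law_eq_if_covariance_eq[where a="a u" and b="a (- u)", OF nz this f]
  have "(\<integral>w. indicator {j} (J w) * (V w \<bullet> u) \<partial>M) = (\<integral>w. indicator {j} (J w) * (V w \<bullet> (- u)) \<partial>M)"
    unfolding f_eq .
  then show ?thesis using self_consistent[OF j] p by simp
qed

text \<open>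
  If \<open>\<nu> > \<mu>\<close>, rotating the points so that \<open>w\<close> is replaced by \<open>e\<close> stretches the scores by the
  factor \<open>sqrt (\<nu> / \<mu>)\<close> in the direction \<open>w\<close>, which lowers the objective.
\<close>

lemma eigenvalue_dominates:
  assumes w: "w \<in> W" "norm w = 1" "C w = \<mu> *\<^sub>R w"
    and e: "norm e = 1" "C e = \<nu> *\<^sub>R e" "\<And>y. y \<in> W \<Longrightarrow> e \<bullet> y = 0"
    and p: "\<And>j. j < k \<Longrightarrow> (\<integral>w. indicator {j} (J w) \<partial>M :: real) \<noteq> 0"
  shows "\<nu> \<le> \<mu>"
proof (rule ccontr)
  assume "\<not> \<nu> \<le> \<mu>"
  then have lm: "\<mu> < \<nu>" by simp
  have ww: "w \<bullet> w = 1" "e \<bullet> e = 1" "e \<bullet> w = 0" "w \<bullet> e = 0"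
    using w(2) e(1) e(3)[OF w(1)] by (simp_all add: norm_eq_1 inner_commute)
  have \<xi>W: "\<xi> j \<in> W" if "j < k" for j using that by (auto intro: span_base)
  define a where "a j = \<xi> j \<bullet> w" for j
  have "0 \<le> C w \<bullet> w" using psd_covariance by (simp add: psd_operator_def)
  then have \<mu>0: "0 \<le> \<mu>" using w(3) ww(1) by simp
  have mean: "(\<integral>x. indicator {j} (J x) * (V x \<bullet> w) \<partial>M) = (\<integral>x. indicator {j} (J x) \<partial>M) * a j" if "j < k" for j
    using self_consistent[OF that] by (simp add: a_def)
  have "\<exists>j<k. a j \<noteq> 0"
  proof (rule ccontr)
    assume "\<not> (\<exists>j<k. a j \<noteq> 0)"
    then have a0: "w \<bullet> \<xi> j = 0" if "j < k" for j
      using that by (auto simp: a_def inner_commute)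
    have "w \<bullet> w = 0"
      by (rule orthogonal_to_span_zero[OF _ w(1)]) (use a0 in auto)
    then show False using ww by simp
  qed
  then obtain j0 where j0: "j0 < k" "a j0 \<noteq> 0" by blast
  have iw: "integrable M (\<lambda>x. a j * (V x \<bullet> w))" for j using integrable_inner_V by simp
  \<comment> \<open>The gain of the stretched points will be at least
    \<open>2 * (s - 1) * E\<close>. By self-consistency \<open>E\<close> is the sum of the squared
    coordinates \<open>a j\<close> weighted by the cell masses, hence positive.\<close>
  define E where "E = (\<integral>x. a (J x) * (V x \<bullet> w) \<partial>M)"
  have iE: "integrable M (\<lambda>x. a (J x) * (V x \<bullet> w))"
    using integral_J_sum(1)[of "\<lambda>j x. a j * (V x \<bullet> w)", OF iw] .
  have E: "E = (\<Sum>j<k. (\<integral>x. indicator {j} (J x) \<partial>M) * (a j)\<^sup>2)"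
  proof -
    have *: "(\<integral>x. indicator {j} (J x) * (a j * (V x \<bullet> w)) \<partial>M) = (\<integral>x. indicator {j} (J x) \<partial>M) * (a j)\<^sup>2"
      if "j < k" for j
    proof -
      have "(\<integral>x. indicator {j} (J x) * (a j * (V x \<bullet> w)) \<partial>M)
          = (\<integral>x. a j * (indicator {j} (J x) * (V x \<bullet> w)) \<partial>M)"
        by (intro Bochner_Integration.integral_cong[OF refl] mult.left_commute)
      also have "\<dots> = a j * (\<integral>x. indicator {j} (J x) * (V x \<bullet> w) \<partial>M)"
        by (rule integral_mult_right_zero)
      also have "\<dots> = a j * ((\<integral>x. indicator {j} (J x) \<partial>M) * a j)"
        unfolding mean[OF that] ..
      finally show ?thesis
        unfolding power2_eq_square by (rule trans) (rule mult.left_commute)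
    qed
    have "E = (\<Sum>j<k. \<integral>x. indicator {j} (J x) * (a j * (V x \<bullet> w)) \<partial>M)"
      unfolding E_def by (rule integral_J_sum(2)[of "\<lambda>j x. a j * (V x \<bullet> w)", OF iw])
    also have "\<dots> = (\<Sum>j<k. (\<integral>x. indicator {j} (J x) \<partial>M) * (a j)\<^sup>2)"
      by (rule sum.cong[OF refl]) (rule *, simp)
    finally show ?thesis .
  qed
  have "E > 0"
    unfolding E
  proof (rule sum_pos2[of _ j0])
    show "j0 \<in> {..<k}" using j0 by simp
    have "0 \<le> (\<integral>x. indicator {j0} (J x) \<partial>M :: real)" by simp
    then have "0 < (\<integral>x. indicator {j0} (J x) \<partial>M :: real)" using p[OF j0(1)] by linarith
    then show "0 < (\<integral>x. indicator {j0} (J x) \<partial>M) * (a j0)\<^sup>2" using j0 by simp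
  qed auto
  \<comment> \<open>With \<open>\<mu> = 0\<close> the variable \<open>V x \<bullet> w\<close> would
    vanish almost surely, and so would \<open>E\<close>.\<close>
  have \<mu>: "0 < \<mu>"
  proof (rule ccontr)
    assume "\<not> 0 < \<mu>"
    then have "C w \<bullet> w = 0" using \<mu>0 w by simp
    then have "(\<integral>x. (V x \<bullet> w) * (V x \<bullet> w) \<partial>M) = 0" by (simp add: covariance_operator_eq)
    then have "AE x in M. V x \<bullet> w = 0"
      using integral_nonneg_eq_0_iff_AE[OF integrable_inner_V_mult[of w w]] by simp
    then have "AE x in M. a (J x) * (V x \<bullet> w) = 0" by eventually_elim simp
    then have "E = 0" unfolding E_def by (rule integral_eq_zero_AE)
    then show False using \<open>E > 0\<close> by simp
  qed
  \<comment> \<open>Stretching \<open>w\<close> by \<open>s\<close> raises its variance from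
    \<open>\<mu>\<close> to \<open>\<nu>\<close>, the variance along \<open>e\<close>.\<close>
  define s where "s = sqrt (\<nu> / \<mu>)"
  have s2: "s\<^sup>2 * \<mu> = \<nu>" using \<mu> lm by (simp add: s_def)
  have s1: "1 < s" using \<mu> lm by (simp add: s_def)
  \<comment> \<open>The competitors \<open>y\<close> move the \<open>w\<close>-coordinate of each
    point to \<open>e\<close> and keep its norm. The vectors \<open>b\<close> stretch that
    coordinate by \<open>s\<close>; they have the covariance form of \<open>y\<close> and serve only
    to rewrite its law.\<close>
  define y where "y j = \<xi> j + a j *\<^sub>R (e - w)" for j
  define b where "b j = \<xi> j + ((s - 1) * a j) *\<^sub>R w" for j
  have ny: "(norm (y j))\<^sup>2 = (norm (\<xi> j))\<^sup>2" if "j < k" for j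
  proof -
    have "\<xi> j \<bullet> e = 0" using e(3)[OF \<xi>W[OF that]] by (simp add: inner_commute)
    then show ?thesis
      unfolding power2_norm_eq_inner y_def using ww
      by (simp add: inner_add inner_diff inner_commute a_def algebra_simps)
  qed
  have sa: "C x \<bullet> y = C y \<bullet> x" for x y
    by (simp add: covariance_operator_eq mult.commute)
  have lin: "C (u + r *\<^sub>R v) \<bullet> z = C u \<bullet> z + r * (C v \<bullet> z)" for u v r z
    using integrable_inner_V_mult
    by (simp add: covariance_operator_eq inner_add_right distrib_right mult.assoc)
  have linr: "C z \<bullet> (u + r *\<^sub>R v) = C z \<bullet> u + r * (C z \<bullet> v)" for u v r z
    by (simp add: inner_add_right)
  have linm: "C (e - w) \<bullet> z = C e \<bullet> z - C w \<bullet> z" for z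
    using lin[of e "-1" w z] by simp
  have form: "C (y i) \<bullet> y l = C (b i) \<bullet> b l" if "i < k" "l < k" for i l
  proof -
    have \<xi>e: "e \<bullet> \<xi> i = 0" "e \<bullet> \<xi> l = 0" using e(3) \<xi>W that by auto
    have vals: "C (\<xi> i) \<bullet> e = 0" "C (\<xi> i) \<bullet> w = \<mu> * a i" "C e \<bullet> \<xi> l = 0" "C w \<bullet> \<xi> l = \<mu> * a l"
      "C e \<bullet> e = \<nu>" "C e \<bullet> w = 0" "C w \<bullet> e = 0" "C w \<bullet> w = \<mu>"
      unfolding sa[of "\<xi> i"] w(3) e(2) by (simp_all add: ww \<xi>e a_def inner_commute[of w "\<xi> _"])
    have "C (y i) \<bullet> y l = C (\<xi> i) \<bullet> \<xi> l + a l * (C (\<xi> i) \<bullet> e - C (\<xi> i) \<bullet> w)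
        + a i * (C e \<bullet> \<xi> l - C w \<bullet> \<xi> l + a l * ((C e \<bullet> e - C e \<bullet> w) - (C w \<bullet> e - C w \<bullet> w)))"
      unfolding y_def lin linr linm inner_diff_right by (simp add: algebra_simps)
    also have "\<dots> = C (\<xi> i) \<bullet> \<xi> l + (\<nu> - \<mu>) * (a i * a l)"
      unfolding vals by (simp add: algebra_simps)
    also have "\<dots> = C (\<xi> i) \<bullet> \<xi> l + (s\<^sup>2 * \<mu> - \<mu>) * (a i * a l)" by (simp add: s2)
    also have "\<dots> = C (\<xi> i) \<bullet> \<xi> l + (s - 1) * a l * (C (\<xi> i) \<bullet> w)
        + (s - 1) * a i * (C w \<bullet> \<xi> l + (s - 1) * a l * (C w \<bullet> w))"
      unfolding vals by (simp add: algebra_simps power2_eq_square)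
    also have "\<dots> = C (b i) \<bullet> b l"
      unfolding b_def lin linr by (simp add: algebra_simps)
    finally show ?thesis .
  qed
  \<comment> \<open>The squared norms are those of \<open>\<xi>\<close>, although the values
    inserted for \<open>z\<close> come from \<open>y\<close> or \<open>b\<close>: \<open>y\<close>
    has these norms, while \<open>b\<close> does not enter as a set of points.\<close>
  define f where "f = (\<lambda>z. Min ((\<lambda>j. (norm (\<xi> j))\<^sup>2 - 2 * z j) ` {..<k}) :: real)"
  have f: "f \<in> borel_measurable (Pi\<^sub>M {..<k} (\<lambda>_. borel))"
    unfolding f_def
    by (intro borel_measurable_Min borel_measurable_diff borel_measurable_times
        measurable_component_singleton) auto
  have nz: "C e \<noteq> 0" using e ww \<mu> lm by auto
  have "(\<integral>x. obj y x \<partial>M) = (\<integral>x. f (\<lambda>i\<in>{..<k}. V x \<bullet> y i) \<partial>M)"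
    by (intro Bochner_Integration.integral_cong refl)
      (auto simp: obj_def f_def score_def ny intro!: arg_cong[where f=Min] image_cong)
  also have "\<dots> = (\<integral>x. f (\<lambda>i\<in>{..<k}. V x \<bullet> b i) \<partial>M)"
    by (rule law_eq_if_covariance_eq[OF nz form f])
  also have "\<dots> \<le> (\<integral>x. obj \<xi> x - 2 * (s - 1) * (a (J x) * (V x \<bullet> w)) \<partial>M)"
  proof (rule integral_mono)
    have eq: "f (\<lambda>i\<in>{..<k}. V x \<bullet> b i) = Min ((\<lambda>j. (norm (\<xi> j))\<^sup>2 - 2 * (V x \<bullet> b j)) ` {..<k})" for x
      unfolding f_def by (intro arg_cong[where f=Min] image_cong) auto
    show "integrable M (\<lambda>x. f (\<lambda>i\<in>{..<k}. V x \<bullet> b i))"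
      unfolding eq by (intro integrable_Min) (use integrable_inner_V in simp)
    show "integrable M (\<lambda>x. obj \<xi> x - 2 * (s - 1) * (a (J x) * (V x \<bullet> w)))"
      using integrable_obj iE by simp
    fix x
    \<comment> \<open>The minimum is bounded by its value at the old index \<open>J x\<close>, where
      the stretch contributes exactly the integrand of \<open>E\<close>.\<close>
    have "f (\<lambda>i\<in>{..<k}. V x \<bullet> b i) \<le> (norm (\<xi> (J x)))\<^sup>2 - 2 * (V x \<bullet> b (J x))"
      unfolding eq using J_less by (intro Min_le) auto
    also have "\<dots> = obj \<xi> x - 2 * (s - 1) * (a (J x) * (V x \<bullet> w))"
      unfolding obj_eq score_def b_def by (simp add: inner_add_right algebra_simps)
    finally show "f (\<lambda>i\<in>{..<k}. V x \<bullet> b i) \<le> obj \<xi> x - 2 * (s - 1) * (a (J x) * (V x \<bullet> w))" .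
  qed
  also have "\<dots> = (\<integral>x. obj \<xi> x \<partial>M) - 2 * (s - 1) * E"
    using integrable_obj iE by (simp add: E_def)
  also have "\<dots> < (\<integral>x. obj \<xi> x \<partial>M)" using s1 \<open>E > 0\<close> by simp
  finally show False using obj_optimal[of y] by simp
qed

text \<open>Supplies the two hypotheses of \<open>leading_eigenfunctions_span\<close>. If
  \<open>C\<close> vanishes on the orthogonal complement of \<open>W\<close>, both follow from
  self-adjointness and positivity. Otherwise some \<open>x\<close> orthogonal to \<open>W\<close>
  has \<open>C x \<noteq> 0\<close>; this excludes null cells and gives the nonzero value needed to
  compare laws.\<close>

lemma principal_subspace_invariant_dominant:
  assumes comp: "compact_operator C"
  shows "C ` W \<subseteq> W \<and> (\<forall>w e \<nu> \<mu>. w \<in> W \<and> norm w = 1 \<and> C w = \<mu> *\<^sub>R w \<and> norm e = 1 \<and> C e = \<nu> *\<^sub>R e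
    \<and> (\<forall>y\<in>W. e \<bullet> y = 0) \<longrightarrow> \<nu> \<le> \<mu>)"
proof (cases "\<forall>u. (\<forall>y\<in>W. u \<bullet> y = 0) \<longrightarrow> C u = 0")
  case True
  have "C w \<in> W" if "w \<in> W" for w
  proof -
    obtain p r where pr: "C w = p + r" "p \<in> W" "\<And>y. y \<in> W \<Longrightarrow> r \<bullet> y = 0"
      using finite_span_decomposition[of "\<xi> ` {..<k}" "C w"] by blast
    \<comment> \<open>Moving \<open>C\<close> to the other side shows that the residual
      \<open>r\<close> of \<open>C w\<close> is orthogonal to \<open>C w\<close>, hence
      zero.\<close>
    have "C r \<bullet> w = 0" using True pr(3) by simp
    then have "r \<bullet> C w = 0" using selfadjoint_covariance by (simp add: selfadjoint_operator_def)
    then have "r \<bullet> r = 0" using pr by (simp add: inner_add_right)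
    then show ?thesis using pr by simp
  qed
  moreover have "\<nu> \<le> \<mu>" if "norm w = 1" "C w = \<mu> *\<^sub>R w" "norm e = 1" "C e = \<nu> *\<^sub>R e" "\<forall>y\<in>W. e \<bullet> y = 0" for w e \<nu> \<mu>
  proof -
    have "\<nu> *\<^sub>R e = 0" using True that by metis
    moreover have "0 \<le> C w \<bullet> w" using psd_covariance by (simp add: psd_operator_def)
    ultimately show ?thesis using that by (auto simp: norm_eq_1)
  qed
  ultimately show ?thesis by blast
next
  case False
  then obtain x where x: "\<forall>y\<in>W. x \<bullet> y = 0" "C x \<noteq> 0" by blast
  \<comment> \<open>A null cell would put \<open>V\<close> on the points almost surely, hence in
    \<open>W\<close>; then \<open>V w \<bullet> x\<close> vanishes almost surely and so does
    \<open>C x\<close>.\<close>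
  have p: "(\<integral>w. indicator {j} (J w) \<partial>M :: real) \<noteq> 0" if "j < k" for j
  proof
    assume "(\<integral>w. indicator {j} (J w) \<partial>M :: real) = 0"
    from concentrated_if_null_cell[OF that this] have "AE w in M. V w \<bullet> x = 0"
    proof eventually_elim
      case (elim w)
      have "\<xi> (J w) \<in> W" using J_less by (intro span_base) auto
      then have "x \<bullet> V w = 0" using x(1) elim by simp
      then show ?case by (subst inner_commute)
    qed
    then have "C x \<bullet> C x = 0" by (rule covariance_form_zero)
    then show False using x(2) by simp
  qed
  have lin: "linear C" using comp by (auto simp: compact_operator_def bounded_linear.linear)
  have "C ` W \<subseteq> W"
  proof (rule invariant_if_orthogonal_image[OF lin])
    fix u w assume u: "\<And>w. w \<in> W \<Longrightarrow> u \<bullet> C w = 0" and w: "w \<in> W"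
    show "u \<bullet> w = 0"
      using w
      by (rule orthogonal_to_span_zero[rotated])
        (use orthogonal_point_if_orthogonal_image[OF x(2) u] p in \<open>auto simp: inner_commute\<close>)
  qed simp
  then show ?thesis using eigenvalue_dominates p by blast
qed

end

theorem theorem3p3:
  fixes M :: "'w measure"
    and V :: "'w \<Rightarrow> 'a::{real_inner, banach, second_countable_topology}"
    and \<xi> :: "nat \<Rightarrow> 'a" and W :: "'a set" and k q :: nat
  assumes "prob_space M"
    and "elliptical M V"
    and "integrable M (\<lambda>w. (norm (V w))\<^sup>2)"
    and "(\<integral>w. V w \<partial>M) = 0"
    and "compact_operator (covariance_operator M V)"
    and "principal_points M V k \<xi>"
    and "W = span (\<xi> ` {..<k})"
    and "dim W = q"
  shows "\<exists>f. leading_eigenfunctions (covariance_operator M V) q f \<and> W = span (f ` {..<q})"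
proof -
  interpret prob_space M by fact
  interpret P: principal_elliptical M V k \<xi>
    by unfold_locales (use assms in auto)
  note * = P.principal_subspace_invariant_dominant[OF assms(5)]
  have "\<exists>f. leading_eigenfunctions (covariance_operator M V) (dim (span (\<xi> ` {..<k}))) f \<and>
      span (\<xi> ` {..<k}) = span (f ` {..<dim (span (\<xi> ` {..<k}))})"
  proof (rule leading_eigenfunctions_span[OF assms(5) P.selfadjoint_covariance P.psd_covariance _ conjunct1[OF *]])
    fix w e l m
    assume "w \<in> P.W" "norm w = 1" "P.C w = m *\<^sub>R w" "norm e = 1" "P.C e = l *\<^sub>R e"
      "\<And>y. y \<in> P.W \<Longrightarrow> e \<bullet> y = 0"
    then show "l \<le> m" by (intro conjunct2[OF *, rule_format, of w m e l] conjI ballI)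
  qed simp
  then show ?thesis
    using assms(7,8) by simp
qed

end
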